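(* Let $q$ be a prime power and $1\le d\le q$. Let $P\mathcal{U}_2\subset\mathbb{P}^3$ be a degenerate Hermitian surface of rank $3$ over $\mathbb{F}_{q^2}$ with vertex $P$, and let $V(F)\subset\mathbb{P}^3$ be an $\mathbb{F}_{q^2}$-surface of degree $d$. Then $|(P\mathcal{U}_2\cap V(F))(\mathbb{F}_{q^2})|=1+q^2d(q+1)$ if and only if $(P\mathcal{U}_2\cap V(F))(\mathbb{F}_{q^2})$ is the union of (the sets of $\mathbb{F}_{q^2}$-points of) $d(q+1)$ distinct $\mathbb{F}_{q^2}$-lines contained in $P\mathcal{U}_2$.
   Context: $\mathbb{P}^3$ is projective $3$-space over $\overline{\mathbb{F}}_q$, $X(\mathbb{F}_{q^2})$ is the set of $\mathbb{F}_{q^2}$-rational points of $X$, and an $\mathbb{F}_{q^2}$-line is a line defined over $\mathbb{F}_{q^2}$. An $\mathbb{F}_{q^2}$-surface of degree $d$ is the zero set $V(F)$ of a nonzero homogeneous $F\in\mathbb{F}_{q^2}[x_0,\dots,x_3]$ of degree $d$ (not necessarily irreducible or reduced). A Hermitian surface of rank $3$ in $\mathbb{P}^3$ is the zero set of $\sum_{i,j}h_{ij}x_ix_j^q$ for a $4\times4$ matrix $H=(h_{ij})$ over $\mathbb{F}_{q^2}$ of rank $3$ with $h_{ij}=h_{ji}^q$. Up to an $\mathbb{F}_{q^2}$-linear change of coordinates it is $V(x_0^{q+1}+x_1^{q+1}+x_2^{q+1})$, a cone with vertex an $\mathbb{F}_{q^2}$-point $P$ (here $P=[0:0:0:1]$)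 over a non-degenerate Hermitian curve $\mathcal{U}_2$ of a plane not through $P$; it is denoted $P\mathcal{U}_2$. *)

theory Defs
  imports
    "HOL-Analysis.Cartesian_Space"
    "HOL-Algebra.Algebraic_Closure_Type"
    "HOL-Library.Poly_Mapping"
    "HOL-Number_Theory.Prime_Powers"
begin

text \<open>
  The base field is a type \<open>'k\<close> and geometric points have coordinates in its algebraic closure
  \<open>'k alg_closure\<close>, into which \<open>'k\<close> is embedded by \<open>to_ac\<close>. A point of projective space is the set
  of all its homogeneous coordinate vectors. The coordinates are indexed by a finite type \<open>'n\<close>;
  projective 3-space is the instance \<open>'n = 4\<close>.
\<close>

type_synonym ('k, 'n) geom_vec = "'k alg_closure ^ 'n"
type_synonym ('k, 'n) proj_pt = "('k, 'n) geom_vec set"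

definition proj_point :: "('k::field, 'n::finite) geom_vec \<Rightarrow> ('k, 'n) proj_pt" where
  "proj_point x = {c *s x | c. c \<noteq> 0}"

definition projectivization :: "('k::field, 'n::finite) geom_vec set \<Rightarrow> ('k, 'n) proj_pt set" where
  "projectivization W = {proj_point x | x. x \<in> W \<and> x \<noteq> 0}"

definition rational_vectors :: "('k::field, 'n::finite) geom_vec set" where
  "rational_vectors = {x. \<forall>i. \<exists>a. x $ i = to_ac a}"

definition rational_points :: "('k::field, 'n::finite) proj_pt set \<Rightarrow> ('k, 'n) proj_pt set" where
  "rational_points A = A \<inter> projectivization rational_vectors"

definition is_line :: "('k::field, 'n::finite) proj_pt set \<Rightarrow> bool" where
  "is_line L \<longleftrightarrow> (\<exists>W. vec.subspace W \<and> vec.dim W = 2 \<and> L = projectivization W)"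

text \<open>
  A subspace is defined over \<open>'k\<close> iff it is spanned by its \<open>'k\<close>-rational vectors.
\<close>

definition is_rational_line :: "('k::field, 'n::finite) proj_pt set \<Rightarrow> bool" where
  "is_rational_line L \<longleftrightarrow> (\<exists>W. vec.subspace W \<and> vec.dim W = 2 \<and>
     vec.span (W \<inter> rational_vectors) = W \<and> L = projectivization W)"

text \<open>
  Polynomials in the variables \<open>x\<^sub>i\<close> (\<open>i :: 'n\<close>) are finitely supported maps from exponent vectors
  to coefficients. The zero polynomial is homogeneous of every degree, so nonzeroness is always
  required separately.
\<close>

type_synonym ('k, 'n) mv_poly = "('n \<Rightarrow>\<^sub>0 nat) \<Rightarrow>\<^sub>0 'k"

definition homogeneous :: "nat \<Rightarrow> ('k::zero, 'n::finite) mv_poly \<Rightarrow> bool" where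
  "homogeneous d F \<longleftrightarrow> (\<forall>m \<in> Poly_Mapping.keys F. (\<Sum>i\<in>UNIV. Poly_Mapping.lookup m i) = d)"

definition eval_poly :: "('k::field, 'n::finite) mv_poly \<Rightarrow> ('k, 'n) geom_vec \<Rightarrow> 'k alg_closure" where
  "eval_poly F x = (\<Sum>m \<in> Poly_Mapping.keys F.
     to_ac (Poly_Mapping.lookup F m) * (\<Prod>i\<in>UNIV. (x $ i) ^ Poly_Mapping.lookup m i))"

definition zero_locus :: "('k::field, 'n::finite) mv_poly \<Rightarrow> ('k, 'n) proj_pt set" where
  "zero_locus F = projectivization {x. eval_poly F x = 0}"

definition hermitian_matrix :: "nat \<Rightarrow> 'k::field ^ 'n ^ 'n \<Rightarrow> bool" where
  "hermitian_matrix q H \<longleftrightarrow> (\<forall>i j. H $ i $ j = (H $ j $ i) ^ q)"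

definition hermitian_variety :: "nat \<Rightarrow> 'k::field ^ 'n ^ 'n \<Rightarrow> ('k, 'n::finite) proj_pt set" where
  "hermitian_variety q H = projectivization
     {x. (\<Sum>i\<in>UNIV. \<Sum>j\<in>UNIV. to_ac (H $ i $ j) * x $ i * (x $ j) ^ q) = 0}"

definition is_hermitian_variety_of_rank ::
    "nat \<Rightarrow> nat \<Rightarrow> ('k::field, 'n::finite) proj_pt set \<Rightarrow> bool" where
  "is_hermitian_variety_of_rank q r S \<longleftrightarrow>
     (\<exists>H :: 'k ^ 'n ^ 'n. hermitian_matrix q H \<and> rank H = r \<and> S = hermitian_variety q H)"

text \<open>
  \<open>S\<close> is a cone with vertex \<open>P\<close> if it contains, with each point \<open>Q \<noteq> P\<close>, the line joining \<open>P\<close>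
  and \<open>Q\<close>.
\<close>

definition is_cone_with_vertex ::
    "('k::field, 'n::finite) proj_pt \<Rightarrow> ('k, 'n) proj_pt set \<Rightarrow> bool" where
  "is_cone_with_vertex P S \<longleftrightarrow> P \<in> S \<and>
     (\<forall>Q\<in>S. Q \<noteq> P \<longrightarrow> (\<forall>L. is_line L \<and> P \<in> L \<and> Q \<in> L \<longrightarrow> L \<subseteq> S))"

end

(* Split F by powers of the coordinate t along the generators of the cone: F = sum_s G_s t^s, where
   G_s has degree d - s in the other three coordinates. If m is the largest s with G_s \<noteq> 0, a generator
   over a point of the Hermitian curve where G_m does not vanish carries at most m points of the
   section besides the vertex, and there are at most (d - m)(q + 1) other generators. The resulting
   bound is smaller than 1 + q^2 d (q + 1) unless m = 0, in which case V(F) is itself a cone with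
   vertex P. Conversely, every line on the cone passes through P.

   The Bezout-type bound on zeros on the curve y^q + y = \<eta> x^(q+1) is the footprint argument for
   Hermitian codes: f times suitably many monomials stays linearly independent on the q^3 affine
   rational points, since leading monomials with respect to the pole order at infinity multiply. *)

theory Submission
  imports Defs "HOL-Number_Theory.Residues"
begin

subsection \<open>Finite fields of square order\<close>

text \<open>The comparison behind the case m > 0 has a margin of at least m (q^2 - 1). At most (d -
  m)(q + 1) generators can be full, with q^2 points each besides the vertex; charging m further
  points to every one of the q^3 + 1 generators gives at most 1 + q^2 (d - m)(q + 1) + m (q^3 + 1),
  whereas the target is 1 + q^2 (d - m)(q + 1) + m (q^3 + q^2). For this the base curve needs the
  projective bound k (q + 1), point at infinity included, so the affine count has to leave room for
  one more zero whenever the form vanishes there. The footprint argument wants the shape y^q + y =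
  \<eta> x^(q+1), with a single point at infinity, rather than the diagonal equation; hence the form
  is split into a hyperbolic pair, an anisotropic vector and the vertex. The bound d \<le> q is what
  lets the weights q i + (q + 1) j separate the monomials of the dehomogenized form. Points and
  lines live over the algebraic closure while all counting takes place in the finite field, so
  incidence has to be translated to vectors over the latter.\<close>

lemma power_card_eq_same:
  fixes x :: "'k::{field,finite}"
  shows "x ^ CARD('k) = x"
proof (cases "x = 0")
  case False
  have "(\<Prod>y\<in>UNIV-{0}. x * y) = (\<Prod>y\<in>UNIV-{0}. y)"
    by (rule prod.reindex_bij_witness[of _ "\<lambda>y. y / x" "\<lambda>y. x * y"]) (use False in auto)
  then have "x ^ (CARD('k) - 1) = 1"
    by (simp add: prod.distrib)
  moreover have "x ^ CARD('k) = x ^ (CARD('k) - 1) * x"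
    by (metis Suc_diff_1 finite_UNIV_card_ge_0 finite_code mult.commute power_Suc)
  ultimately show ?thesis by simp
qed simp

text \<open>A nonzero polynomial has no more roots than its degree. The coefficients are a plain
  function, so they may depend on further variables; this permits arguing one variable at a
  time.\<close>

lemma poly_function_eq_0D:
  fixes a :: "nat \<Rightarrow> 'a::idom"
  assumes "finite S" "n \<le> card S" "\<And>x. x \<in> S \<Longrightarrow> (\<Sum>e<n. a e * x ^ e) = 0" "e < n"
  shows "a e = 0"
proof -
  define p where "p = (\<Sum>e<n. monom (a e) e)"
  have coeff: "coeff p i = (if i < n then a i else 0)" for i
    by (auto simp: p_def coeff_sum when_def)
  have "p = 0"
  proof (rule ccontr)
    assume p: "p \<noteq> 0"
    have "S \<subseteq> {x. poly p x = 0}"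
      using assms(3) by (auto simp: p_def poly_sum poly_monom)
    then have "card S \<le> degree p"
      using card_poly_roots_bound[OF p] poly_roots_finite[OF p] card_mono le_trans by blast
    moreover have "degree p < n"
      using assms(4) by (metis coeff leading_coeff_0_iff p)
    ultimately show False using assms(2) by simp
  qed
  then show ?thesis using coeff[of e] assms(4) by simp
qed

locale hermitian_field =
  fixes q :: nat and K :: "'k::{field,finite} itself"
  assumes primepow_q: "primepow q" and card_K: "CARD('k) = q ^ 2"
begin

lemma q_ge_2: "2 \<le> q"
  using primepow_gt_Suc_0[OF primepow_q] by simp

text \<open>The characteristic is a prime dividing q^2, hence the prime of which q is a
  power.\<close>

lemma frob_add: "(x + y) ^ q = x ^ q + (y :: 'k) ^ q"
proof -
  obtain p n where p: "prime p" "q = p ^ n"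
    using primepow_q by (auto simp: primepow_def)
  have "CHAR('k) dvd p ^ (n * 2)"
    using CHAR_dvd_CARD[where ?'a = 'k] card_K p by (simp add: power_mult)
  moreover have "prime CHAR('k)"
    by (rule prime_CHAR_semidom) (simp add: finite_imp_CHAR_pos)
  ultimately have "CHAR('k) = p"
    using p by (metis prime_dvd_power primes_dvd_imp_eq)
  then show ?thesis
    using p by (intro freshmans_dream') auto
qed

lemma frob_0 [simp]: "(0 :: 'k) ^ q = 0"
  using q_ge_2 by simp

lemma frob_minus: "(- x) ^ q = - ((x :: 'k) ^ q)"
  using frob_add[of x "- x"] by (simp add: eq_neg_iff_add_eq_0 add.commute)

lemma frob_diff: "(x - y) ^ q = x ^ q - (y :: 'k) ^ q"
  using frob_add[of x "- y"] by (simp add: frob_minus)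

lemma frob_sum: "(\<Sum>i\<in>A. f i) ^ q = (\<Sum>i\<in>A. (f i :: 'k) ^ q)"
  by (induction A rule: infinite_finite_induct) (auto simp: frob_add)

lemma frob_frob [simp]: "((x :: 'k) ^ q) ^ q = x"
  using power_card_eq_same[of x] by (simp add: card_K power2_eq_square flip: power_mult)

lemma card_trace_fibre_le: "card {y :: 'k. y ^ q + y = c} \<le> q"
proof -
  define p where "p = monom 1 q + monom 1 1 - [:c:]"
  have "coeff p q = 1"
    using q_ge_2 by (auto simp: p_def coeff_pCons split: nat.splits)
  then have "p \<noteq> 0" by auto
  have "degree p \<le> q"
    unfolding p_def using q_ge_2
    by (intro degree_diff_le degree_add_le) (auto simp: degree_monom_eq)
  moreover have "{y. y ^ q + y = c} = {y. poly p y = 0}"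
    by (auto simp: p_def poly_monom)
  ultimately show ?thesis
    using card_poly_roots_bound[OF \<open>p \<noteq> 0\<close>] by simp
qed

lemma card_fixed_le: "card {c :: 'k. c ^ q = c} \<le> q"
proof -
  define p :: "'k poly" where "p = monom 1 q - monom 1 1"
  have "coeff p q = 1"
    using q_ge_2 by (auto simp: p_def)
  then have "p \<noteq> 0" by auto
  have "degree p \<le> q"
    unfolding p_def using q_ge_2 by (intro degree_diff_le) (auto simp: degree_monom_eq)
  moreover have "{c. c ^ q = c} = {c. poly p c = 0}"
    by (auto simp: p_def poly_monom)
  ultimately show ?thesis
    using card_poly_roots_bound[OF \<open>p \<noteq> 0\<close>] by simp
qed

text \<open>The \<open>q\<^sup>2\<close> elements of the field are distributed over at most \<open>q\<close> fibres of the trace, each of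
  size at most \<open>q\<close>, so every fibre is full.\<close>

lemma card_trace_fibre:
  assumes "c ^ q = (c :: 'k)"
  shows "card {y :: 'k. y ^ q + y = c} = q"
proof (rule ccontr)
  assume neq: "card {y. y ^ q + y = c} \<noteq> q"
  let ?C = "{c :: 'k. c ^ q = c}" and ?F = "\<lambda>c :: 'k. {y. y ^ q + y = c}"
  have "(\<Union>c\<in>?C. ?F c) = UNIV"
    by (auto simp: frob_add add.commute)
  then have "q ^ 2 = card (\<Union>c\<in>?C. ?F c)"
    by (simp add: card_K)
  also have "\<dots> = (\<Sum>c\<in>?C. card (?F c))"
    by (rule card_UN_disjoint) auto
  also have "\<dots> < (\<Sum>c\<in>?C. q)"
    by (rule sum_strict_mono_ex1)
      (use assms neq card_trace_fibre_le in \<open>auto simp: le_neq_implies_less\<close>)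
  also have "\<dots> \<le> q * q"
    using card_fixed_le by simp
  finally show False by (simp add: power2_eq_square)
qed

lemma trace_surj:
  assumes "c ^ q = (c :: 'k)"
  obtains y where "y ^ q + y = c"
  using card_trace_fibre[OF assms] q_ge_2 by fastforce

lemma trace_nonzero: obtains t :: 'k where "t ^ q + t \<noteq> 0"
  using trace_surj[of 1] by (metis one_neq_zero power_one)

text \<open>The q^2 - 1 nonzero elements are distributed by t^(q+1) over at most q - 1 nonzero fixed
  elements, with fibres of size at most q + 1. There is no room for an empty fibre.\<close>

lemma norm_surj:
  assumes "a ^ q = (a :: 'k)" "a \<noteq> 0"
  obtains t where "t ^ (q + 1) = a" "t \<noteq> 0"
proof -
  let ?C = "{c :: 'k. c ^ q = c} - {0}" and ?F = "\<lambda>c :: 'k. {y. y ^ (q + 1) = c}"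
  have F_le: "card (?F c) \<le> q + 1" for c
  proof -
    define p where "p = monom 1 (q + 1) - [:c:]"
    have "coeff p (q + 1) = 1"
      by (auto simp: p_def coeff_pCons)
    then have "p \<noteq> 0" by auto
    have "degree p \<le> q + 1"
      unfolding p_def by (intro degree_diff_le) (auto simp: degree_monom_eq)
    moreover have "?F c = {y. poly p y = 0}"
      by (auto simp: p_def poly_monom)
    ultimately show ?thesis
      using card_poly_roots_bound[OF \<open>p \<noteq> 0\<close>] by simp
  qed
  have "?F a \<noteq> {}"
  proof
    assume empty: "?F a = {}"
    have "UNIV - {0} \<subseteq> (\<Union>c\<in>?C - {a}. ?F c)"
      using empty by (auto simp: power_mult_distrib mult.commute)
    then have "card (UNIV - {0 :: 'k}) \<le> card (\<Union>c\<in>?C - {a}. ?F c)"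
      by (rule card_mono[rotated]) simp
    then have "q ^ 2 - 1 \<le> card (\<Union>c\<in>?C - {a}. ?F c)"
      by (simp add: card_K card_Diff_subset)
    also have "\<dots> \<le> (\<Sum>c\<in>?C - {a}. card (?F c))"
      by (rule card_UN_le) simp
    also have "\<dots> \<le> (\<Sum>c\<in>?C - {a}. q + 1)"
      by (rule sum_mono) (use F_le in blast)
    also have "\<dots> = card (?C - {a}) * (q + 1)" by simp
    also have "\<dots> \<le> (q - 2) * (q + 1)"
      by (rule mult_right_mono)
        (use card_fixed_le assms in \<open>auto simp: card_Diff_singleton card_Diff_subset\<close>)
    finally have "q ^ 2 - 1 \<le> (q - 2) * (q + 1)" .
    \<comment> \<open>With q = m + 2 the truncated subtractions can be evaluated; the excess m + 3 =
      q + 1 is the size of the missing fibre.\<close>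
    moreover obtain m where m: "q = 2 + m"
      using le_Suc_ex[OF q_ge_2] by blast
    have "q ^ 2 - 1 = (q - 2) * (q + 1) + (m + 3)"
      unfolding m by (simp add: power2_eq_square algebra_simps)
    ultimately show False by linarith
  qed
  then obtain t where "t ^ (q + 1) = a" by blast
  moreover from this assms(2) have "t \<noteq> 0" by auto
  ultimately show ?thesis by (rule that)
qed

end

subsection \<open>Zeros of low-degree polynomials on a Hermitian curve\<close>

text \<open>The pole orders of \<open>x\<close> and \<open>y\<close> at the point at infinity of the curve
  \<open>y\<^sup>q + y = \<eta> x\<^bsup>q+1\<^esup>\<close> are \<open>q\<close> and \<open>q + 1\<close>.\<close>

definition (in hermitian_field) wt :: "nat \<Rightarrow> nat \<Rightarrow> nat" where
  "wt i j = q * i + (q + 1) * j"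

locale hermitian_curve = hermitian_field q K
  for q :: nat and K :: "'k::{field,finite} itself" +
  fixes \<eta> :: 'k
  assumes \<eta>_nonzero: "\<eta> \<noteq> 0" and \<eta>_fixed: "\<eta> ^ q = \<eta>"
begin

definition curve :: "('k \<times> 'k) set" where
  "curve = {(x, y). y ^ q + y = \<eta> * x ^ (q + 1)}"

text \<open>Both \<eta> and the norm x^(q+1) are fixed by the Frobenius map, so each x lies under a
  full fibre of the trace.\<close>

lemma card_curve_fibre: "card {y. (x, y) \<in> curve} = q"
  using card_trace_fibre[of "\<eta> * x ^ (q + 1)"]
  by (simp add: curve_def power_mult_distrib \<eta>_fixed mult.commute)

lemma card_curve: "card curve = q ^ 3"
proof -
  have "card (SIGMA x:UNIV. {y. (x, y) \<in> curve}) = q ^ 3"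
    by (simp add: card_curve_fibre card_K power_numeral_reduce)
  moreover have "(SIGMA x:UNIV. {y. (x, y) \<in> curve}) = curve"
    by auto
  ultimately show ?thesis by simp
qed

text \<open>The normal form of a function on the rational points: y^q = \<eta> x^(q+1) - y and
  x^(q^2) = x reduce every monomial to these, and their number q^2 * q equals the number of
  points.\<close>

definition box :: "(nat \<Rightarrow> nat \<Rightarrow> 'k) \<Rightarrow> 'k \<Rightarrow> 'k \<Rightarrow> 'k" where
  "box c x y = (\<Sum>i<q\<^sup>2. \<Sum>j<q. c i j * x ^ i * y ^ j)"

text \<open>For fixed x there are q roots y for a polynomial of degree below q in y; each of its
  coefficients is then a polynomial of degree below q^2 in x that vanishes on the whole
  field.\<close>

lemma box_eq_0D:
  assumes zero: "\<And>x y. (x, y) \<in> curve \<Longrightarrow> box c x y = 0" and "i < q\<^sup>2" "j < q"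
  shows "c i j = 0"
proof -
  have "(\<Sum>i<q\<^sup>2. c i j * x ^ i) = 0" for x
  proof (rule poly_function_eq_0D[where a = "\<lambda>j. \<Sum>i<q\<^sup>2. c i j * x ^ i"])
    show "finite {y. (x, y) \<in> curve}" "q \<le> card {y. (x, y) \<in> curve}"
      by (simp_all add: card_curve_fibre)
    fix y assume "y \<in> {y. (x, y) \<in> curve}"
    then have "(\<Sum>j<q. \<Sum>i<q\<^sup>2. c i j * x ^ i * y ^ j) = 0"
      using zero by (subst sum.swap) (auto simp: box_def)
    then show "(\<Sum>j<q. (\<Sum>i<q\<^sup>2. c i j * x ^ i) * y ^ j) = 0"
      by (simp add: sum_distrib_right)
  qed fact
  then show ?thesis
    using poly_function_eq_0D[of UNIV "q\<^sup>2" "\<lambda>i. c i j"] \<open>i < q\<^sup>2\<close> by (simp add: card_K)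
qed

text \<open>The functions whose normal form has pole order below \<open>n\<close> at infinity. Only
  values on the curve are compared, which builds in the reduction modulo its equation.\<close>

definition low :: "nat \<Rightarrow> ('k \<Rightarrow> 'k \<Rightarrow> 'k) \<Rightarrow> bool" where
  "low n \<phi> \<longleftrightarrow> (\<exists>c. (\<forall>i j. n \<le> wt i j \<longrightarrow> c i j = 0) \<and> (\<forall>x y. (x, y) \<in> curve \<longrightarrow> \<phi> x y = box c x y))"

lemma box_0: "box (\<lambda>i j. 0) x y = 0"
  by (simp add: box_def)

lemma box_add: "box (\<lambda>i j. c i j + d i j) x y = box c x y + box d x y"
  by (simp add: box_def sum.distrib distrib_right)

lemma box_cmult: "box (\<lambda>i j. a * c i j) x y = a * box c x y"
  by (simp add: box_def sum_distrib_left mult.assoc)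

lemma box_single:
  assumes "i < q\<^sup>2" "j < q"
  shows "box (\<lambda>i' j'. if i' = i \<and> j' = j then a else 0) x y = a * x ^ i * y ^ j"
proof -
  have "(\<Sum>j'<q. (if i' = i \<and> j' = j then a else 0) * x ^ i' * y ^ j') =
      (if i' = i then a * x ^ i * y ^ j else 0)" for i'
  proof (cases "i' = i")
    case True
    have "(\<Sum>j'<q. (if j' = j then a else 0) * x ^ i * y ^ j') =
        (\<Sum>j'<q. if j' = j then a * x ^ i * y ^ j else 0)"
      by (intro sum.cong) auto
    then show ?thesis using True assms by simp
  qed simp
  then show ?thesis
    using assms by (simp add: box_def)
qed

lemma lowI:
  assumes "\<And>i j. n \<le> wt i j \<Longrightarrow> c i j = 0" "\<And>x y. (x, y) \<in> curve \<Longrightarrow> \<phi> x y = box c x y"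
  shows "low n \<phi>"
  using assms unfolding low_def by (intro exI[of _ c]) simp

lemma lowE:
  assumes "low n \<phi>"
  obtains c where "\<And>i j. n \<le> wt i j \<Longrightarrow> c i j = 0"
    "\<And>x y. (x, y) \<in> curve \<Longrightarrow> \<phi> x y = box c x y"
proof -
  from assms obtain c where "\<forall>i j. n \<le> wt i j \<longrightarrow> c i j = 0"
    "\<forall>x y. (x, y) \<in> curve \<longrightarrow> \<phi> x y = box c x y"
    unfolding low_def by (elim exE conjE)
  then show ?thesis by (intro that[of c]) simp_all
qed

lemma low_0: "low n (\<lambda>x y. 0)"
  by (rule lowI[of _ "\<lambda>i j. 0"]) (simp_all add: box_0)

lemma low_add:
  assumes "low n \<phi>" "low n \<psi>"
  shows "low n (\<lambda>x y. \<phi> x y + \<psi> x y)"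
proof (rule lowE[OF assms(1)], rule lowE[OF assms(2)])
  fix c d
  assume "\<And>i j. n \<le> wt i j \<Longrightarrow> c i j = 0" "\<And>x y. (x, y) \<in> curve \<Longrightarrow> \<phi> x y = box c x y"
    "\<And>i j. n \<le> wt i j \<Longrightarrow> d i j = 0" "\<And>x y. (x, y) \<in> curve \<Longrightarrow> \<psi> x y = box d x y"
  then show ?thesis
    by (intro lowI[of n "\<lambda>i j. c i j + d i j"]) (simp_all add: box_add)
qed

lemma low_cmult:
  assumes "low n \<phi>"
  shows "low n (\<lambda>x y. a * \<phi> x y)"
proof (rule lowE[OF assms])
  fix c
  assume "\<And>i j. n \<le> wt i j \<Longrightarrow> c i j = 0" "\<And>x y. (x, y) \<in> curve \<Longrightarrow> \<phi> x y = box c x y"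
  then show ?thesis
    by (intro lowI[of n "\<lambda>i j. a * c i j"]) (simp_all add: box_cmult)
qed

lemma low_sum:
  assumes "\<And>m. m \<in> M \<Longrightarrow> low n (\<phi> m)"
  shows "low n (\<lambda>x y. \<Sum>m\<in>M. \<phi> m x y)"
  using assms by (induction M rule: infinite_finite_induct) (simp_all add: low_0 low_add)

lemma low_cong:
  assumes "low n \<phi>" "\<And>x y. (x, y) \<in> curve \<Longrightarrow> \<psi> x y = \<phi> x y"
  shows "low n \<psi>"
proof (rule lowE[OF assms(1)])
  fix c
  assume "\<And>i j. n \<le> wt i j \<Longrightarrow> c i j = 0" "\<And>x y. (x, y) \<in> curve \<Longrightarrow> \<phi> x y = box c x y"
  with assms(2) show ?thesis
    by (intro lowI[of n c]) simp_all
qed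

text \<open>The rewriting rule for y^q. On the right the first monomial has the weight of the
  left-hand side and the second a smaller one.\<close>

lemma curve_reduce:
  assumes "(x, y) \<in> curve" "q \<le> j"
  shows "x ^ i * y ^ j = \<eta> * (x ^ (i + q + 1) * y ^ (j - q)) + (- 1) * (x ^ i * y ^ (j - q + 1))"
proof -
  have "y ^ q + y = \<eta> * x ^ (q + 1)"
    using assms(1) unfolding curve_def by (simp only: mem_Collect_eq prod.case)
  then have yq: "y ^ q = \<eta> * x ^ (q + 1) - y"
    by (simp only: eq_diff_eq)
  obtain l where l: "j = l + q"
    using assms(2) by (metis add.commute le_Suc_ex)
  have "u * (v * (e * w - z)) = e * (u * w * v) + (- 1) * (u * (v * z))" for u v e w z :: 'k
    by (simp add: algebra_simps)
  from this[of "x ^ i" "y ^ l" \<eta> "x ^ (q + 1)" y] show ?thesis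
    unfolding l add_diff_cancel_right' power_add[of y l q] yq
    by (simp only: add.assoc power_add[of x i "q + 1"] power_add[of y l 1] power_one_right)
qed

text \<open>Reduction to normal form never raises the weight. Lowering the y-exponent may raise the
  x-exponent, so \<open>i\<close> is arbitrary in the outer induction; once j < q, the inner one
  lowers the x-exponent by q^2 - 1.\<close>

lemma low_monom: "wt i j < n \<Longrightarrow> low n (\<lambda>x y. x ^ i * y ^ j)"
proof (induction j arbitrary: i rule: less_induct)
  case (less j)
  show ?case
  proof (cases "j < q")
    case True
    from less.prems show ?thesis
    proof (induction i rule: less_induct)
      case (less i)
      show ?case
      proof (cases "i < q\<^sup>2")
        case True
        then show ?thesis
          using less.prems \<open>j < q\<close>
          by (intro lowI[of n "\<lambda>i' j'. if i' = i \<and> j' = j then 1 else 0"])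
            (auto simp: box_single[of i j 1])
      next
        case False
        have "1 < q\<^sup>2"
          using q_ge_2 by (metis one_less_power less_le_trans one_less_numeral_iff
              semiring_norm(76) zero_less_numeral)
        have "x ^ i = x ^ (i - q\<^sup>2 + 1)" for x :: 'k
        proof -
          have "x ^ i = x ^ (i - q\<^sup>2) * x ^ q\<^sup>2"
            using False by (simp flip: power_add)
          also have "x ^ q\<^sup>2 = x"
            using power_card_eq_same[of x] card_K by simp
          finally show ?thesis by (simp add: power_add)
        qed
        moreover have "low n (\<lambda>x y. x ^ (i - q\<^sup>2 + 1) * y ^ j)"
        proof (rule less.IH)
          show "i - q\<^sup>2 + 1 < i"
            using False \<open>1 < q\<^sup>2\<close> by simp
          then have "q * (i - q\<^sup>2 + 1) \<le> q * i"
            by (intro mult_left_mono) auto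
          then show "wt (i - q\<^sup>2 + 1) j < n"
            using less.prems by (simp add: wt_def)
        qed
        ultimately show ?thesis by simp
      qed
    qed
  next
    case False
    then have "q \<le> j" by simp
    have wt1: "wt (i + q + 1) (j - q) = wt i j"
    proof -
      obtain l where "j = q + l" using \<open>q \<le> j\<close> le_Suc_ex by blast
      then show ?thesis by (simp add: wt_def algebra_simps)
    qed
    have wt2: "wt i (j - q + 1) \<le> wt i j"
      unfolding wt_def using \<open>q \<le> j\<close> q_ge_2 by (intro add_left_mono mult_left_mono) auto
    have "low n (\<lambda>x y. \<eta> * (x ^ (i + q + 1) * y ^ (j - q)) + (- 1) * (x ^ i * y ^ (j - q + 1)))"
      using \<open>q \<le> j\<close> q_ge_2 less.prems wt1 wt2
      by (intro low_add low_cmult less.IH) auto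
    then show ?thesis
      by (rule low_cong) (rule curve_reduce[OF _ \<open>q \<le> j\<close>])
  qed
qed

text \<open>The two alternatives are the monomials whose reduction keeps the weight: those in the
  box, and those reaching it by a single use of the curve equation. Reducing by x^(q^2) = x would
  lose weight and spoil the leading term, whence the bounds on the x-exponent.\<close>

lemma leading_term_nonzero:
  assumes "j < q \<and> i < q\<^sup>2 \<or> q \<le> j \<and> j < 2 * q \<and> i + q + 1 < q\<^sup>2"
    and "low (wt i j) \<phi>" and "a \<noteq> 0"
  obtains x y where "(x, y) \<in> curve" "a * (x ^ i * y ^ j) + \<phi> x y \<noteq> 0"
proof -
  \<comment> \<open>A leading monomial already in the box keeps its coefficient \<open>a\<close>,
    because the normal form of \<phi> has no term of that weight.\<close>
  have *: False if "j < q" "i < q\<^sup>2" "low (wt i j) \<phi>" "a \<noteq> 0"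
    "\<And>x y. (x, y) \<in> curve \<Longrightarrow> a * (x ^ i * y ^ j) + \<phi> x y = 0" for i j \<phi> a
  proof -
    obtain c where c: "\<And>i' j'. wt i j \<le> wt i' j' \<Longrightarrow> c i' j' = 0"
      "\<And>x y. (x, y) \<in> curve \<Longrightarrow> \<phi> x y = box c x y"
      using lowE[OF \<open>low (wt i j) \<phi>\<close>] by metis
    let ?d = "\<lambda>i' j'. (if i' = i \<and> j' = j then a else 0) + c i' j'"
    have "?d i j = 0"
    proof (rule box_eq_0D[of ?d])
      fix x y assume "(x, y) \<in> curve"
      then show "box ?d x y = 0"
        using that(5)[of x y] c(2) unfolding box_add box_single[OF \<open>i < q\<^sup>2\<close> \<open>j < q\<close>]
        by (auto simp: mult.assoc)
    qed fact+
    then show False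
      using c(1) \<open>a \<noteq> 0\<close> by simp
  qed
  have "\<exists>(x, y)\<in>curve. a * (x ^ i * y ^ j) + \<phi> x y \<noteq> 0"
  proof (rule ccontr)
    assume "\<not> ?thesis"
    then have zero: "a * (x ^ i * y ^ j) + \<phi> x y = 0" if "(x, y) \<in> curve" for x y
      using that by auto
    from assms(1) show False
    proof (elim disjE conjE)
      assume "j < q" "i < q\<^sup>2"
      then show False
        using * zero assms(2,3) by blast
    next
      assume j: "q \<le> j" "j < 2 * q" "i + q + 1 < q\<^sup>2"
      have wt_eq: "wt (i + q + 1) (j - q) = wt i j" "wt i (j - q + 1) < wt i j"
      proof -
        obtain l where l: "j = q + l" using \<open>q \<le> j\<close> le_Suc_ex by blast
        then show "wt (i + q + 1) (j - q) = wt i j"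
          by (simp add: wt_def algebra_simps)
        have "j - q + 1 < j" using l q_ge_2 by simp
        then show "wt i (j - q + 1) < wt i j"
          unfolding wt_def by (intro add_strict_left_mono mult_strict_left_mono) auto
      qed
      \<comment> \<open>The leading monomial is traded for x^(i+q+1) y^(j-q) with coefficient a
        \<eta>; the by-product of smaller weight is absorbed into \<phi>.\<close>
      show False
      proof (rule *)
        show "j - q < q" "i + q + 1 < q\<^sup>2" "a * \<eta> \<noteq> 0"
          using j \<open>a \<noteq> 0\<close> \<eta>_nonzero by auto
        show "low (wt (i + q + 1) (j - q)) (\<lambda>x y. (- a) * (x ^ i * y ^ (j - q + 1)) + \<phi> x y)"
          unfolding wt_eq(1)
          by (intro low_add low_cmult low_monom) (use wt_eq assms(2) in auto)
        fix x y assume "(x, y) \<in> curve"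
        have "a * \<eta> * u + ((- a) * v + w) = a * (\<eta> * u + (- 1) * v) + w" for u v w
          by (simp add: algebra_simps)
        then show "a * \<eta> * (x ^ (i + q + 1) * y ^ (j - q)) +
            ((- a) * (x ^ i * y ^ (j - q + 1)) + \<phi> x y) = 0"
          using zero[OF \<open>(x, y) \<in> curve\<close>]
          unfolding curve_reduce[OF \<open>(x, y) \<in> curve\<close> \<open>q \<le> j\<close>, of i] by (simp only:)
      qed
    qed
  qed
  then show ?thesis using that by blast
qed

section \<open>Weights of monomials and the count of zeros\<close>

lemma wt_add: "wt (a + i) (b + j) = wt a b + wt i j"
  by (simp add: wt_def algebra_simps)

text \<open>The weight is q (i + j) + j, so j is its residue modulo q.\<close>

lemma wt_inj:
  assumes "wt i j = wt i' j'" "j < q" "j' < q"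
  shows "i = i' \<and> j = j'"
proof -
  have "q * (i + j) + j = q * (i' + j') + j'"
    using assms(1) by (simp add: wt_def algebra_simps)
  then have "(q * (i + j) + j) mod q = (q * (i' + j') + j') mod q"
    "(q * (i + j) + j) div q = (q * (i' + j') + j') div q"
    by simp_all
  then show ?thesis
    using assms(2,3) by simp
qed

text \<open>Total degree at most q admits one exponent outside the range of residues, namely b = q
  with a = 0. Its weight q q + q can only be reached with b' = q as well.\<close>

lemma wt_inj_total_degree:
  assumes "wt a b = wt a' b'" "a + b \<le> q" "a' + b' \<le> q"
  shows "a = a' \<and> b = b'"
proof (cases "b = q \<or> b' = q")
  case False
  then have "b < q" "b' < q" using assms by auto
  then show ?thesis using wt_inj[OF assms(1)] by simp
next
  case True
  have *: "a = a' \<and> b = b'" if "wt a b = wt a' b'" "b = q" "a + b \<le> q" "a' + b' \<le> q" for a b a' b'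
  proof -
    have "q * q + q = q * (a' + b') + b'"
      using that by (simp add: wt_def algebra_simps)
    moreover have "q * (a' + b') \<le> q * q"
      using that by (intro mult_left_mono) auto
    ultimately have "b' \<ge> q" by linarith
    then show ?thesis using that by auto
  qed
  show ?thesis
    using True *[of a b a' b'] *[of a' b' a b] assms by auto
qed

text \<open>Multiplying f by combinations of the monomials in \<open>A\<close> is injective as a map
  to functions on the points where f does not vanish. Hence there are at least |A| such points among
  q^3, and |A| = q^3 - wt a b.\<close>

lemma card_zeros_le_wt:
  assumes "k \<le> q" and ab: "a + b \<le> k" "c (a, b) \<noteq> 0"
    and max: "\<And>a' b'. a' + b' \<le> k \<Longrightarrow> c (a', b') \<noteq> 0 \<Longrightarrow> wt a' b' \<le> wt a b"
  shows "card {(x, y) \<in> curve. (\<Sum>(a, b) | a + b \<le> k. c (a, b) * x ^ a * y ^ b) = 0} \<le> wt a b"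
proof -
  define D where "D = {(a, b). a + b \<le> k}"
  have "finite D"
    by (rule finite_subset[of _ "{..k} \<times> {..k}"]) (auto simp: D_def)
  define f where "f x y = (\<Sum>(a, b)\<in>D. c (a, b) * x ^ a * y ^ b)" for x y
  define S where "S = {(x, y) \<in> curve. f x y = 0}"
  \<comment> \<open>The box monomials whose product with the leading monomial x^a y^b of f stays
    within the reach of \<open>leading_term_nonzero\<close>; the second branch is an overflow of the
    y-exponent past q.\<close>
  define A where "A = {(i, j). j < q \<and> (if j + b < q then i + a < q\<^sup>2 else i + a + q + 1 < q\<^sup>2)}"
  have "b \<le> q" "a \<le> q" using assms by auto
  have "q * 2 \<le> q * q" using q_ge_2 by (intro mult_left_mono) auto
  then have q2: "2 * q \<le> q\<^sup>2" by (simp add: power2_eq_square)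
  have A_eq: "A = {..<q\<^sup>2 - a} \<times> {..<q - b} \<union> {..<q\<^sup>2 - a - q - 1} \<times> {q - b..<q}"
    using q2 by (auto simp: A_def split: if_splits)
  have "finite A" unfolding A_eq by simp
  have "card A = card ({..<q\<^sup>2 - a} \<times> {..<q - b}) + card ({..<q\<^sup>2 - a - q - 1} \<times> {q - b..<q})"
    unfolding A_eq by (rule card_Un_disjoint) auto
  also have "\<dots> = (q\<^sup>2 - a) * (q - b) + (q\<^sup>2 - a - q - 1) * b"
    using \<open>b \<le> q\<close> by (simp add: card_cartesian_product)
  \<comment> \<open>For b > 0 the subtractions are genuine, since then a + q + 1 \<le> 2 q \<le>
    q^2. For b = 0 one of them may be truncated, but the second rectangle is empty.\<close>
  finally have card_A: "card A + wt a b = q ^ 3"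
  proof (cases "b = 0")
    case False
    then have "a + q + 1 \<le> q\<^sup>2"
      using q2 assms by simp
    then obtain u where u: "q\<^sup>2 = a + q + 1 + u" using le_Suc_ex by blast
    obtain v where v: "q = b + v" using \<open>b \<le> q\<close> le_Suc_ex by blast
    have "card A = (q + 1 + u) * v + u * b"
      using \<open>card A = _\<close> u v by simp
    then have "card A + wt a b = (q + 1 + u) * v + u * b + q * a + (q + 1) * b"
      by (simp add: wt_def)
    also have "\<dots> = (q + 1 + u + a) * (b + v)"
      using v by (simp add: algebra_simps)
    also have "\<dots> = q ^ 3"
      using u v by (simp add: power3_eq_cube power2_eq_square)
    finally show ?thesis .
  next
    case True
    have "a \<le> q\<^sup>2" using \<open>a \<le> q\<close> q2 by simp
    then obtain u where u: "q\<^sup>2 = a + u" using le_Suc_ex by blast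
    then have "card A + wt a b = (a + u) * q"
      using \<open>card A = _\<close> True by (simp add: wt_def algebra_simps)
    then show ?thesis
      using u by (simp add: power3_eq_cube power2_eq_square)
  qed

  define h where "h g x y = (\<Sum>(i, j)\<in>A. g (i, j) * x ^ i * y ^ j)" for g :: "nat \<times> nat \<Rightarrow> 'k" and x y
  \<comment> \<open>Restricting to the complement of \<open>S\<close> loses nothing, as every
    product f h vanishes on \<open>S\<close>.\<close>
  define \<Phi> where "\<Phi> g = restrict (\<lambda>(x, y). f x y * h g x y) (curve - S)" for g
  have zero: "g ij = 0" if vanish: "\<And>x y. (x, y) \<in> curve \<Longrightarrow> f x y * h g x y = 0" and "ij \<in> A" for g ij
  proof (rule ccontr)
    assume "g ij \<noteq> 0"
    let ?N = "{ij \<in> A. g ij \<noteq> 0}"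
    \<comment> \<open>The leading monomial of h; with that of f it yields the leading monomial of
      the product.\<close>
    obtain i j where ij: "(i, j) \<in> ?N" "\<And>i' j'. (i', j') \<in> ?N \<Longrightarrow> wt i' j' \<le> wt i j"
    proof -
      have "ij \<in> ?N" using \<open>g ij \<noteq> 0\<close> \<open>ij \<in> A\<close> by simp
      then have "finite ?N" "?N \<noteq> {}" using \<open>finite A\<close> by (simp, blast)
      then have "Max (case_prod wt ` ?N) \<in> case_prod wt ` ?N" by (intro Max_in) auto
      then obtain i j where ij: "(i, j) \<in> ?N" "wt i j = Max (case_prod wt ` ?N)"
        by (metis (no_types, lifting) imageE old.prod.case prod.exhaust)
      have "case_prod wt p \<le> Max (case_prod wt ` ?N)" if "p \<in> ?N" for p
        using that \<open>finite ?N\<close> by (intro Max_ge finite_imageI imageI)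
      from this[of "(i', j')" for i' j'] show ?thesis
        by (intro that[OF ij(1)]) (simp add: ij(2))
    qed
    define T where "T = D \<times> A - {((a, b), (i, j))}"
    define \<phi> where "\<phi> x y = (\<Sum>p\<in>T. (c (fst p) * g (snd p)) *
        (x ^ (fst (fst p) + fst (snd p)) * y ^ (snd (fst p) + snd (snd p))))" for x y
    have split: "f x y * h g x y = (c (a, b) * g (i, j)) * (x ^ (a + i) * y ^ (b + j)) + \<phi> x y" for x y
    proof -
      have "f x y * h g x y = (\<Sum>p\<in>D \<times> A. (c (fst p) * g (snd p)) *
          (x ^ (fst (fst p) + fst (snd p)) * y ^ (snd (fst p) + snd (snd p))))"
        unfolding f_def h_def sum_product sum.cartesian_product
        by (intro sum.cong) (auto simp: power_add)
      also have "\<dots> = (c (a, b) * g (i, j)) * (x ^ (a + i) * y ^ (b + j)) + \<phi> x y"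
        unfolding \<phi>_def T_def
        using \<open>finite D\<close> \<open>finite A\<close> ij ab by (subst sum.remove[of _ "((a, b), (i, j))"]) (auto simp: D_def)
      finally show ?thesis .
    qed
    have "low (wt (a + i) (b + j)) \<phi>"
      unfolding \<phi>_def
    proof (rule low_sum)
      fix p assume p: "p \<in> T"
      obtain a' b' i' j' where p_eq: "p = ((a', b'), (i', j'))"
        by (metis prod.exhaust)
      show "low (wt (a + i) (b + j)) (\<lambda>x y. (c (fst p) * g (snd p)) *
          (x ^ (fst (fst p) + fst (snd p)) * y ^ (snd (fst p) + snd (snd p))))"
      proof (cases "c (a', b') = 0 \<or> g (i', j') = 0")
        case True
        then show ?thesis by (auto simp: p_eq low_0)
      next
        case False
        then have le: "wt a' b' \<le> wt a b" "wt i' j' \<le> wt i j"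
          using p max ij(2) by (auto simp: T_def D_def p_eq)
        \<comment> \<open>Weights are injective both on the exponents of f and on \<open>A\<close>,
          so any other pair of terms is strictly lighter in one factor.\<close>
        have "wt a' b' \<noteq> wt a b \<or> wt i' j' \<noteq> wt i j"
          using p ij(1) \<open>k \<le> q\<close> ab wt_inj_total_degree[of a' b' a b] wt_inj[of i' j' i j]
          by (auto simp: T_def D_def A_def p_eq)
        then have "wt (a' + i') (b' + j') < wt (a + i) (b + j)"
          using le unfolding wt_add by linarith
        then show ?thesis
          by (simp add: p_eq low_cmult low_monom)
      qed
    qed
    moreover have "b + j < q \<and> a + i < q\<^sup>2 \<or> q \<le> b + j \<and> b + j < 2 * q \<and> a + i + q + 1 < q\<^sup>2"
      using ij(1) \<open>b \<le> q\<close> by (auto simp: A_def split: if_splits)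
    moreover have "c (a, b) * g (i, j) \<noteq> 0"
      using ij ab by simp
    ultimately obtain x y where "(x, y) \<in> curve"
      "(c (a, b) * g (i, j)) * (x ^ (a + i) * y ^ (b + j)) + \<phi> x y \<noteq> 0"
      using leading_term_nonzero by metis
    then show False
      using split vanish by metis
  qed
  have "inj_on \<Phi> (A \<rightarrow>\<^sub>E UNIV)"
  proof
    fix g g' assume g: "g \<in> A \<rightarrow>\<^sub>E UNIV" "g' \<in> A \<rightarrow>\<^sub>E UNIV" "\<Phi> g = \<Phi> g'"
    have "f x y * h (\<lambda>p. g p - g' p) x y = 0" if "(x, y) \<in> curve" for x y
    proof (cases "(x, y) \<in> S")
      case True
      then show ?thesis by (simp add: S_def)
    next
      case False
      then have "f x y * h g x y = f x y * h g' x y"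
        using fun_cong[OF g(3), of "(x, y)"] that by (simp add: \<Phi>_def)
      moreover have "h (\<lambda>p. g p - g' p) x y = h g x y - h g' x y"
        by (simp add: h_def case_prod_beta left_diff_distrib sum_subtractf)
      ultimately show ?thesis by (simp add: right_diff_distrib)
    qed
    then have "g p - g' p = 0" if "p \<in> A" for p
      using zero that by blast
    then show "g = g'"
      using g by (intro PiE_ext[of g A "\<lambda>_. UNIV" g']) auto
  qed
  moreover have "\<Phi> ` (A \<rightarrow>\<^sub>E UNIV) \<subseteq> (curve - S) \<rightarrow>\<^sub>E UNIV"
    by (intro image_subsetI) (simp add: \<Phi>_def restrict_PiE_iff)
  ultimately have "card (A \<rightarrow>\<^sub>E (UNIV :: 'k set)) \<le> card ((curve - S) \<rightarrow>\<^sub>E (UNIV :: 'k set))"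
    by (intro card_inj_on_le) (auto intro: finite_PiE)
  then have "(q\<^sup>2) ^ card A \<le> (q\<^sup>2) ^ card (curve - S)"
    using \<open>finite A\<close> by (simp add: card_PiE card_K)
  then have "card A \<le> card (curve - S)"
    using q2 q_ge_2 by (subst (asm) power_increasing_iff) auto
  also have "\<dots> = q ^ 3 - card S"
    using card_curve by (subst card_Diff_subset) (auto simp: S_def)
  finally have "card A \<le> q ^ 3 - card S" .
  moreover have "S \<subseteq> curve"
    by (auto simp: S_def)
  then have "card S \<le> q ^ 3"
    using card_mono[of curve S] card_curve by simp
  ultimately have "card S \<le> wt a b"
    using card_A by linarith
  then show ?thesis
    by (simp add: S_def f_def D_def)
qed

text \<open>The extra 1 is the point at infinity, where the homogenized form takes the value
  \<open>c (0, k)\<close>. The leading weight is (a + b)(q + 1) - a, which reaches k (q + 1) only if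
  the leading monomial is y^k, and then that value is nonzero.\<close>

theorem card_curve_zeros_le:
  assumes "k \<le> q" "a0 + b0 \<le> k" "c (a0, b0) \<noteq> 0"
  shows "card {(x, y) \<in> curve. (\<Sum>(a, b) | a + b \<le> k. c (a, b) * x ^ a * y ^ b) = 0} +
      (if c (0, k) = 0 then 1 else 0) \<le> k * (q + 1)"
proof -
  define D where "D = {(a, b). a + b \<le> k \<and> c (a, b) \<noteq> 0}"
  have "finite D"
    by (rule finite_subset[of _ "{..k} \<times> {..k}"]) (auto simp: D_def)
  moreover have "D \<noteq> {}" using assms by (auto simp: D_def)
  ultimately have "Max (case_prod wt ` D) \<in> case_prod wt ` D" by (intro Max_in) auto
  then obtain a b where ab: "(a, b) \<in> D" "wt a b = Max (case_prod wt ` D)"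
    by (metis (no_types, lifting) imageE old.prod.case prod.exhaust)
  have max: "wt a' b' \<le> wt a b" if "a' + b' \<le> k" "c (a', b') \<noteq> 0" for a' b'
  proof -
    have "(a', b') \<in> D" using that by (simp add: D_def)
    then have "case_prod wt (a', b') \<le> Max (case_prod wt ` D)"
      using \<open>finite D\<close> by (intro Max_ge finite_imageI imageI)
    then show ?thesis by (simp add: ab(2))
  qed
  have "card {(x, y) \<in> curve. (\<Sum>(a, b) | a + b \<le> k. c (a, b) * x ^ a * y ^ b) = 0} \<le> wt a b"
    using assms ab max by (intro card_zeros_le_wt) (auto simp: D_def)
  moreover have "wt a b + a = (a + b) * (q + 1)"
    by (simp add: wt_def algebra_simps)
  moreover have "(a + b) * (q + 1) \<le> k * (q + 1)"
    using ab by (intro mult_right_mono) (auto simp: D_def)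
  moreover have "(a + b) * (q + 1) < k * (q + 1)" if "a = 0" "c (0, k) = 0"
    using ab that by (intro mult_strict_right_mono) (auto simp: D_def le_less)
  ultimately show ?thesis
    by (cases "a = 0") auto
qed

end

subsection \<open>Homogeneous polynomials as functions\<close>

text \<open>One variable is split off at a time: grouping the monomials by their exponent in
  \<open>j\<close> gives a polynomial in that variable whose coefficients must vanish. Abstract
  indices with exponents \<open>ex\<close> let the remaining variables be treated with a smaller
  index set and no change of type.\<close>

lemma monomial_functions_independent:
  fixes c :: "'m \<Rightarrow> 'k::{field,finite}" and ex :: "'m \<Rightarrow> 'n \<Rightarrow> nat"
  assumes "finite I" "finite A" "\<And>m i. m \<in> A \<Longrightarrow> i \<in> I \<Longrightarrow> ex m i < CARD('k)"
    and "\<And>m m'. m \<in> A \<Longrightarrow> m' \<in> A \<Longrightarrow> (\<forall>i\<in>I. ex m i = ex m' i) \<Longrightarrow> m = m'"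
    and "\<And>v :: 'n \<Rightarrow> 'k. (\<Sum>m\<in>A. c m * (\<Prod>i\<in>I. v i ^ ex m i)) = 0" and "m \<in> A"
  shows "c m = 0"
  using assms
proof (induction I arbitrary: A m rule: finite_induct)
  case empty
  then have "A = {m}" by auto
  then show ?case using empty.prems(4) by simp
next
  case (insert j I)
  define A' where "A' e = {m \<in> A. ex m j = e}" for e
  have "(\<Sum>m\<in>A' (ex m j). c m * (\<Prod>i\<in>I. v i ^ ex m i)) = 0" for v :: "'n \<Rightarrow> 'k"
  proof (rule poly_function_eq_0D[of UNIV "CARD('k)" "\<lambda>e. \<Sum>m\<in>A' e. c m * (\<Prod>i\<in>I. v i ^ ex m i)"])
    fix x :: 'k
    have "(\<Sum>e<CARD('k). (\<Sum>m\<in>A' e. c m * (\<Prod>i\<in>I. v i ^ ex m i)) * x ^ e) =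
        (\<Sum>e<CARD('k). \<Sum>m\<in>A' e. c m * (\<Prod>i\<in>I. v i ^ ex m i) * x ^ ex m j)"
      unfolding sum_distrib_right by (intro sum.cong) (auto simp: A'_def)
    also have "\<dots> = (\<Sum>m\<in>A. c m * (\<Prod>i\<in>I. v i ^ ex m i) * x ^ ex m j)"
      unfolding A'_def using insert.prems by (intro sum.group) auto
    also have "\<dots> = (\<Sum>m\<in>A. c m * (\<Prod>i\<in>insert j I. (v(j := x)) i ^ ex m i))"
    proof (rule sum.cong)
      fix m
      have "(\<Prod>i\<in>I. (v(j := x)) i ^ ex m i) = (\<Prod>i\<in>I. v i ^ ex m i)"
        using insert.hyps by (intro prod.cong) auto
      then show "c m * (\<Prod>i\<in>I. v i ^ ex m i) * x ^ ex m j =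
          c m * (\<Prod>i\<in>insert j I. (v(j := x)) i ^ ex m i)"
        using insert.hyps by simp
    qed simp
    finally show "(\<Sum>e<CARD('k). (\<Sum>m\<in>A' e. c m * (\<Prod>i\<in>I. v i ^ ex m i)) * x ^ e) = 0"
      using insert.prems(4) by simp
  qed (use insert.prems in auto)
  then show ?case
    using insert.prems by (intro insert.IH[of "A' (ex m j)" m]) (auto simp: A'_def)
qed

section \<open>Evaluation on vectors over the base field\<close>

definition to_ac_vec :: "'k::field ^ 'n \<Rightarrow> ('k, 'n::finite) geom_vec" where
  "to_ac_vec v = (\<chi> i. to_ac (v $ i))"

definition poly_fun :: "('k::field, 'n::finite) mv_poly \<Rightarrow> 'k ^ 'n \<Rightarrow> 'k" where
  "poly_fun F v = (\<Sum>m\<in>Poly_Mapping.keys F.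
     Poly_Mapping.lookup F m * (\<Prod>i\<in>UNIV. (v $ i) ^ Poly_Mapping.lookup m i))"

lemma eval_poly_to_ac_vec: "eval_poly F (to_ac_vec v) = to_ac (poly_fun F v)"
  by (simp add: eval_poly_def poly_fun_def to_ac_vec_def to_ac_sum to_ac_prod)

text \<open>All exponents are at most d, hence below the field size, so distinct monomials are
  independent as functions. From here on F can be handled as a function, independently of
  coordinates.\<close>

lemma poly_fun_nonzero:
  fixes F :: "('k::{field,finite}, 'n::finite) mv_poly"
  assumes "F \<noteq> 0" "homogeneous d F" "d < CARD('k)"
  obtains v where "poly_fun F v \<noteq> 0"
proof (rule ccontr)
  assume "\<not> thesis"
  then have zero: "poly_fun F v = 0" for v using that by blast
  obtain m where m: "m \<in> Poly_Mapping.keys F"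
    using \<open>F \<noteq> 0\<close> by (metis all_not_in_conv keys_eq_empty)
  have "Poly_Mapping.lookup F m = 0"
  proof (rule monomial_functions_independent[of UNIV _ Poly_Mapping.lookup])
    fix m i assume "m \<in> Poly_Mapping.keys F"
    then have "(\<Sum>i\<in>UNIV. Poly_Mapping.lookup m i) = d"
      using assms(2) by (auto simp: homogeneous_def)
    then have "Poly_Mapping.lookup m i \<le> d"
      using member_le_sum[of i UNIV "Poly_Mapping.lookup m"] by simp
    then show "Poly_Mapping.lookup m i < CARD('k)" using assms(3) by simp
  next
    fix v :: "'n \<Rightarrow> 'k"
    show "(\<Sum>m\<in>Poly_Mapping.keys F. Poly_Mapping.lookup F m *
        (\<Prod>i\<in>UNIV. v i ^ Poly_Mapping.lookup m i)) = 0"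
      using zero[of "\<chi> i. v i"] by (simp add: poly_fun_def)
  qed (use m in \<open>auto intro: poly_mapping_eqI\<close>)
  then show False using m by (simp add: in_keys_iff)
qed

section \<open>Forms in four variables as functions with a coefficient family\<close>

definition triples :: "nat \<Rightarrow> (nat \<times> nat \<times> nat) set" where
  "triples d = {(a, b, s). a + b + s \<le> d}"

lemma finite_triples [simp]: "finite (triples d)"
  by (rule finite_subset[of _ "{..d} \<times> {..d} \<times> {..d}"]) (auto simp: triples_def)

text \<open>Since the total degree is known, the exponent of \<open>z\<close> is determined by the other three.\<close>

definition quaternary_form :: "nat \<Rightarrow> ('a \<Rightarrow> 'a \<Rightarrow> 'a \<Rightarrow> 'a \<Rightarrow> 'a::comm_ring_1) \<Rightarrow> bool" where
  "quaternary_form d g \<longleftrightarrow> (\<exists>c. \<forall>x y z t.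
     g x y z t = (\<Sum>(a, b, s)\<in>triples d. c (a, b, s) * (x ^ a * y ^ b * z ^ (d - a - b - s) * t ^ s)))"

lemma quaternary_form_0: "quaternary_form d (\<lambda>x y z t. 0)"
  unfolding quaternary_form_def by (rule exI[of _ "\<lambda>_. 0"]) (simp add: case_prod_beta)

lemma quaternary_form_add:
  assumes "quaternary_form d g" "quaternary_form d h"
  shows "quaternary_form d (\<lambda>x y z t. g x y z t + h x y z t)"
proof -
  from assms obtain c c' where
    "\<And>x y z t. g x y z t = (\<Sum>(a, b, s)\<in>triples d. c (a, b, s) * (x ^ a * y ^ b * z ^ (d - a - b - s) * t ^ s))"
    "\<And>x y z t. h x y z t = (\<Sum>(a, b, s)\<in>triples d. c' (a, b, s) * (x ^ a * y ^ b * z ^ (d - a - b - s) * t ^ s))"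
    unfolding quaternary_form_def by blast
  then show ?thesis
    unfolding quaternary_form_def
    by (intro exI[of _ "\<lambda>p. c p + c' p"]) (simp add: case_prod_beta distrib_right sum.distrib)
qed

lemma quaternary_form_cmult:
  assumes "quaternary_form d g"
  shows "quaternary_form d (\<lambda>x y z t. k * g x y z t)"
proof -
  from assms obtain c where
    "\<And>x y z t. g x y z t = (\<Sum>(a, b, s)\<in>triples d. c (a, b, s) * (x ^ a * y ^ b * z ^ (d - a - b - s) * t ^ s))"
    unfolding quaternary_form_def by blast
  then show ?thesis
    unfolding quaternary_form_def
    by (intro exI[of _ "\<lambda>p. k * c p"]) (simp add: case_prod_beta sum_distrib_left mult.assoc)
qed

lemma quaternary_form_sum:
  assumes "\<And>m. m \<in> M \<Longrightarrow> quaternary_form d (g m)"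
  shows "quaternary_form d (\<lambda>x y z t. \<Sum>m\<in>M. g m x y z t)"
  using assms
  by (induction M rule: infinite_finite_induct) (auto simp: quaternary_form_0 quaternary_form_add)

lemma quaternary_form_monom:
  assumes "d = a + b + e + s"
  shows "quaternary_form d (\<lambda>x y z t. x ^ a * y ^ b * z ^ e * t ^ s)"
proof -
  have "x ^ a * y ^ b * z ^ e * t ^ s = (\<Sum>(a', b', s')\<in>triples d.
      (if (a', b', s') = (a, b, s) then 1 else 0) * (x ^ a' * y ^ b' * z ^ (d - a' - b' - s') * t ^ s'))"
    for x y z t :: 'a
  proof -
    have "(\<Sum>(a', b', s')\<in>triples d.
        (if (a', b', s') = (a, b, s) then 1 else 0) * (x ^ a' * y ^ b' * z ^ (d - a' - b' - s') * t ^ s')) =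
      (\<Sum>p\<in>triples d. if p = (a, b, s) then x ^ a * y ^ b * z ^ e * t ^ s else 0)"
    proof (rule sum.cong[OF refl])
      fix p
      show "(case p of (a', b', s') \<Rightarrow> (if (a', b', s') = (a, b, s) then 1 else 0) *
            (x ^ a' * y ^ b' * z ^ (d - a' - b' - s') * t ^ s')) =
          (if p = (a, b, s) then x ^ a * y ^ b * z ^ e * t ^ s else 0)"
        by (cases "p = (a, b, s)") (auto simp: assms case_prod_beta prod_eq_iff)
    qed
    also have "\<dots> = x ^ a * y ^ b * z ^ e * t ^ s"
    proof -
      have "(a, b, s) \<in> triples d"
        using assms by (simp add: triples_def)
      then show ?thesis by simp
    qed
    finally show ?thesis ..
  qed
  then show ?thesis
    unfolding quaternary_form_def by (intro exI[of _ "\<lambda>p. if p = (a, b, s) then 1 else 0"]) blast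
qed

lemma quaternary_form_mult:
  assumes "quaternary_form d g" "quaternary_form d' h"
  shows "quaternary_form (d + d') (\<lambda>x y z t. g x y z t * h x y z t)"
proof -
  from assms obtain c c' where
    g: "\<And>x y z t. g x y z t = (\<Sum>(a, b, s)\<in>triples d. c (a, b, s) * (x ^ a * y ^ b * z ^ (d - a - b - s) * t ^ s))"
    and h: "\<And>x y z t. h x y z t = (\<Sum>(a, b, s)\<in>triples d'. c' (a, b, s) * (x ^ a * y ^ b * z ^ (d' - a - b - s) * t ^ s))"
    unfolding quaternary_form_def by blast
  let ?gh = "\<lambda>x y z t. \<Sum>p\<in>triples d \<times> triples d'. c (fst p) * c' (snd p) *
      (x ^ (fst (fst p) + fst (snd p)) * y ^ (fst (snd (fst p)) + fst (snd (snd p))) *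
       z ^ ((d - fst (fst p) - fst (snd (fst p)) - snd (snd (fst p))) +
            (d' - fst (snd p) - fst (snd (snd p)) - snd (snd (snd p)))) *
       t ^ (snd (snd (fst p)) + snd (snd (snd p))))"
  have "(\<lambda>x y z t. g x y z t * h x y z t) = ?gh"
    unfolding g h sum_product sum.cartesian_product
    by (intro ext sum.cong) (auto simp: power_add mult_ac)
  moreover have "quaternary_form (d + d') ?gh"
    by (intro quaternary_form_sum quaternary_form_cmult quaternary_form_monom) (auto simp: triples_def)
  ultimately show ?thesis by simp
qed

lemma quaternary_form_power:
  assumes "quaternary_form 1 g"
  shows "quaternary_form n (\<lambda>x y z t. g x y z t ^ n)"
proof (induction n)
  case 0
  show ?case using quaternary_form_monom[of 0 0 0 0 0] by simp
next
  case (Suc n)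
  then show ?case using quaternary_form_mult[OF assms Suc] by simp
qed

lemma quaternary_form_prod:
  assumes "finite I" "\<And>i. i \<in> I \<Longrightarrow> quaternary_form (n i) (g i)"
  shows "quaternary_form (\<Sum>i\<in>I. n i) (\<lambda>x y z t. \<Prod>i\<in>I. g i x y z t)"
  using assms
proof (induction I rule: finite_induct)
  case empty
  show ?case using quaternary_form_monom[of 0 0 0 0 0] by simp
next
  case (insert i I)
  then show ?case by (simp add: quaternary_form_mult)
qed

lemma quaternary_form_linear:
  "quaternary_form 1 (\<lambda>x y z t. x * \<alpha> + y * \<beta> + z * \<gamma> + t * \<delta>)"
proof -
  have "quaternary_form 1 (\<lambda>x y z t. \<alpha> * (x ^ 1 * y ^ 0 * z ^ 0 * t ^ 0) + \<beta> * (x ^ 0 * y ^ 1 * z ^ 0 * t ^ 0)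
      + \<gamma> * (x ^ 0 * y ^ 0 * z ^ 1 * t ^ 0) + \<delta> * (x ^ 0 * y ^ 0 * z ^ 0 * t ^ 1))"
    by (intro quaternary_form_add quaternary_form_cmult quaternary_form_monom) auto
  then show ?thesis by (simp add: mult.commute)
qed

text \<open>Each coordinate of the argument is a linear form in x, y, z, t, and degrees add under
  products. Asking only for some coefficient family avoids defining a change of variables on
  polynomials.\<close>

lemma poly_fun_linear_substitution:
  assumes "homogeneous d F"
  shows "quaternary_form d (\<lambda>x y z t. poly_fun F (x *s e0 + y *s e1 + z *s e2 + t *s e3))"
  unfolding poly_fun_def
proof (intro quaternary_form_sum quaternary_form_cmult)
  fix m assume "m \<in> Poly_Mapping.keys F"
  then have d: "d = (\<Sum>i\<in>UNIV. Poly_Mapping.lookup m i)"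
    using assms by (auto simp: homogeneous_def)
  show "quaternary_form d (\<lambda>x y z t. \<Prod>i\<in>UNIV.
      ((x *s e0 + y *s e1 + z *s e2 + t *s e3) $ i) ^ Poly_Mapping.lookup m i)"
    unfolding d vector_add_component vector_smult_component
    by (intro quaternary_form_prod quaternary_form_power quaternary_form_linear) simp
qed

subsection \<open>Hermitian forms\<close>

text \<open>The rows are annihilated by two independent vectors. Two unit vectors can then be
  adjoined to a basis of the row space without losing independence, each being detected by one of
  the annihilating vectors.\<close>

lemma rank_le_of_kernel:
  fixes A :: "'a::field ^ 'n ^ 'm"
  assumes "A *v u = 0" "A *v p = 0" "p \<noteq> 0" "\<And>c. u \<noteq> c *s p"
  shows "rank A + 2 \<le> CARD('n)"
proof -
  obtain i where i: "p $ i \<noteq> 0"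
    using \<open>p \<noteq> 0\<close> by (auto simp: vec_eq_iff)
  \<comment> \<open>The kernel vector corrected to vanish at coordinate i, so that it annihilates
    the first adjoined unit vector but not the second.\<close>
  define w where "w = u - (u $ i / p $ i) *s p"
  have "w \<noteq> 0" using assms(4) by (simp add: w_def)
  then obtain j where j: "w $ j \<noteq> 0" by (auto simp: vec_eq_iff)
  have "w $ i = 0" using i by (simp add: w_def)
  have "A *v w = 0"
    using assms(1,2) by (simp add: w_def matrix_vector_mult_diff_distrib vec.scale)
  define ann where "ann v = {r :: 'a ^ 'n. (\<Sum>l\<in>UNIV. r $ l * v $ l) = 0}" for v
  have subspace_ann: "vec.subspace (ann v)" for v
  proof (rule vec.subspaceI)
    fix r s c assume "r \<in> ann v" "s \<in> ann v"
    then show "r + s \<in> ann v"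
      by (simp add: ann_def distrib_right sum.distrib)
  next
    fix c r assume "r \<in> ann v"
    moreover have "(\<Sum>l\<in>UNIV. (c *s r) $ l * v $ l) = c * (\<Sum>l\<in>UNIV. r $ l * v $ l)"
      by (simp add: sum_distrib_left mult.assoc)
    ultimately show "c *s r \<in> ann v" by (simp only: ann_def mem_Collect_eq mult_zero_right)
  qed (simp add: ann_def)
  have rows_ann: "rows A \<subseteq> ann v" if "A *v v = 0" for v
  proof
    fix r assume "r \<in> rows A"
    then obtain l where "r = A $ l" by (auto simp: rows_def row_def)
    moreover have "(A *v v) $ l = 0" using that by simp
    ultimately show "r \<in> ann v" by (simp add: ann_def matrix_vector_mult_def)
  qed
  have axis_ann: "axis l 1 \<in> ann v \<longleftrightarrow> v $ l = 0" for l v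
  proof -
    have "(\<Sum>l'\<in>UNIV. axis l 1 $ l' * v $ l') = (\<Sum>l'\<in>UNIV. if l' = l then v $ l else 0)"
      by (intro sum.cong) (auto simp: axis_def)
    then show ?thesis by (simp add: ann_def)
  qed
  obtain B where B: "B \<subseteq> rows A" "vec.independent B" "rows A \<subseteq> vec.span B"
    "card B = vec.dim (rows A)"
    by (rule vec.basis_exists)
  have "vec.span B \<subseteq> ann p"
    using B(1) rows_ann[OF assms(2)] by (intro vec.span_minimal subspace_ann) simp
  then have i_notin: "axis i 1 \<notin> vec.span B"
    using i axis_ann[of i p] by auto
  have "axis i 1 \<in> ann w"
    using \<open>w $ i = 0\<close> axis_ann by simp
  then have "vec.span (insert (axis i 1) B) \<subseteq> ann w"
    using B(1) rows_ann[OF \<open>A *v w = 0\<close>] by (intro vec.span_minimal subspace_ann) simp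
  then have j_notin: "axis j 1 \<notin> vec.span (insert (axis i 1) B)"
    using j axis_ann[of j w] by auto
  have ind: "vec.independent (insert (axis j 1) (insert (axis i 1) B))"
    by (intro vec.independent_insertI j_notin i_notin B(2))
  have "axis i 1 \<notin> B" "axis j 1 \<notin> insert (axis i 1) B"
    using i_notin j_notin vec.span_base by metis+
  moreover have "finite B"
    by (rule vec.finiteI_independent[OF B(2)])
  ultimately have "card (insert (axis j 1) (insert (axis i 1) B)) = rank A + 2"
    using B(4) by (simp add: row_rank_def_gen)
  moreover have "card (insert (axis j 1) (insert (axis i 1) B)) \<le> vec.dim (UNIV :: ('a ^ 'n) set)"
    using ind by (intro vec.independent_card_le_dim) auto
  ultimately show ?thesis unfolding vec_dim_card by simp
qed

section \<open>The Hermitian form, isotropic vectors and the radical\<close>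

locale hermitian_form = hermitian_field q K
  for q :: nat and K :: "'k::{field,finite} itself" +
  fixes H :: "'k ^ 'n::finite ^ 'n"
  assumes hermitian_H: "hermitian_matrix q H"
begin

definition herm :: "'k ^ 'n \<Rightarrow> 'k ^ 'n \<Rightarrow> 'k" where
  "herm u v = (\<Sum>i\<in>UNIV. \<Sum>j\<in>UNIV. H $ i $ j * u $ i * (v $ j) ^ q)"

lemma herm_add_left [simp]: "herm (u + v) w = herm u w + herm v w"
  unfolding herm_def sum.distrib[symmetric] by (intro sum.cong refl) (simp add: algebra_simps)

lemma herm_add_right [simp]: "herm u (v + w) = herm u v + herm u w"
  unfolding herm_def sum.distrib[symmetric]
  by (intro sum.cong refl) (simp add: algebra_simps frob_add)

lemma herm_scale_left [simp]: "herm (c *s u) w = c * herm u w"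
  unfolding herm_def sum_distrib_left by (intro sum.cong refl) simp

lemma herm_scale_right [simp]: "herm u (c *s w) = c ^ q * herm u w"
  unfolding herm_def sum_distrib_left by (intro sum.cong refl) (simp add: power_mult_distrib)

lemma herm_diff_left [simp]: "herm (u - v) w = herm u w - herm v w"
  using herm_add_left[of "u - v" v w] by simp

lemma herm_diff_right [simp]: "herm w (u - v) = herm w u - herm w v"
  using herm_add_right[of w "u - v" v] by simp

lemma herm_0_left [simp]: "herm 0 w = 0"
  by (simp add: herm_def)

lemma herm_sym: "herm v u = herm u v ^ q"
proof -
  have "herm u v ^ q = (\<Sum>i\<in>UNIV. \<Sum>j\<in>UNIV. (H $ i $ j) ^ q * (u $ i) ^ q * v $ j)"
    by (simp add: herm_def frob_sum power_mult_distrib)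
  also have "\<dots> = (\<Sum>i\<in>UNIV. \<Sum>j\<in>UNIV. H $ j $ i * v $ j * (u $ i) ^ q)"
  proof (intro sum.cong refl)
    fix i j
    have "(H $ i $ j) ^ q = H $ j $ i"
      using hermitian_H unfolding hermitian_matrix_def by metis
    then show "(H $ i $ j) ^ q * (u $ i) ^ q * v $ j = H $ j $ i * v $ j * (u $ i) ^ q"
      by (simp add: mult.assoc mult.commute)
  qed
  also have "\<dots> = herm v u"
    unfolding herm_def by (rule sum.swap)
  finally show ?thesis ..
qed

lemma herm_self_fixed: "herm u u ^ q = herm u u"
  by (rule herm_sym[symmetric])

lemma herm_eq_0_sym: "herm u v = 0 \<Longrightarrow> herm v u = 0"
  using herm_sym[of v u] by simp

text \<open>If u and w are both isotropic, the form at a u + w is the trace of a * herm u w, and a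
  can be chosen to make this trace nonzero. Contrapositively, the form vanishes identically on a
  span only if the spanning vectors are orthogonal.\<close>

lemma polarization:
  assumes "herm u w \<noteq> 0"
  obtains a b where "herm (a *s u + b *s w) (a *s u + b *s w) \<noteq> 0"
proof (cases "herm u u = 0 \<and> herm w w = 0")
  case False
  then show ?thesis using that[of 1 0] that[of 0 1] by auto
next
  case True
  obtain t :: 'k where t: "t ^ q + t \<noteq> 0" by (rule trace_nonzero)
  let ?a = "t / herm u w"
  have "herm (?a *s u + 1 *s w) (?a *s u + 1 *s w) = t ^ q + t"
    using True assms by (simp add: herm_sym[of w u] power_divide)
  then show ?thesis using t that by metis
qed

text \<open>Adding c u changes the value at v by the trace of c * herm u v. The value to be
  cancelled is fixed by the Frobenius map, hence is a trace.\<close>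

lemma isotropic_adjust:
  assumes "herm u u = 0" "herm u v \<noteq> 0"
  obtains c where "herm (v + c *s u) (v + c *s u) = 0"
proof -
  obtain y where y: "y ^ q + y = - herm v v"
    using trace_surj[of "- herm v v"] by (auto simp: frob_minus herm_self_fixed)
  have "herm (v + (y / herm u v) *s u) (v + (y / herm u v) *s u) = herm v v + (y ^ q + y)"
    using assms by (simp add: herm_sym[of v u] power_divide)
  then have "herm (v + (y / herm u v) *s u) (v + (y / herm u v) *s u) = 0"
    by (simp only: y) simp
  then show ?thesis by (rule that)
qed

definition radical :: "('k ^ 'n) set" where
  "radical = {v. \<forall>w. herm v w = 0}"

text \<open>Otherwise some isotropic vector is not orthogonal to p, and by polarization its span
  with p contains an anisotropic vector, although the cone property makes this whole span
  isotropic.\<close>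

lemma vertex_in_radical:
  assumes "herm p p = 0"
    and cone: "\<And>v c. herm v v = 0 \<Longrightarrow> herm (p + c *s v) (p + c *s v) = 0"
  shows "p \<in> radical"
proof (rule ccontr)
  assume "p \<notin> radical"
  then obtain v where v: "herm p v \<noteq> 0" by (auto simp: radical_def)
  obtain c where c: "herm (v + c *s p) (v + c *s p) = 0"
    by (rule isotropic_adjust[OF assms(1) v])
  define v' where "v' = v + c *s p"
  have "herm p v' \<noteq> 0" using v assms(1) by (simp add: v'_def)
  then obtain a b where ab: "herm (a *s p + b *s v') (a *s p + b *s v') \<noteq> 0"
    by (rule polarization)
  \<comment> \<open>A multiple of the isotropic \<open>v'\<close> alone would be isotropic.\<close>
  have "a \<noteq> 0" using ab c by (auto simp: v'_def[symmetric])
  then have "a *s p + b *s v' = a *s (p + (b / a) *s v')"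
    by (simp add: vec.scale_right_distrib)
  moreover have "herm (p + (b / a) *s v') (p + (b / a) *s v') = 0"
    using cone c by (simp only: v'_def)
  ultimately show False using ab by (metis herm_scale_left herm_scale_right mult_zero_right)
qed

text \<open>The form is semilinear in its second argument, so it is the Frobenius conjugates of
  radical vectors that lie in the kernel of \<open>H\<close>, which is one-dimensional by the rank
  assumption.\<close>

lemma radical_multiple:
  assumes rank: "rank H + 1 = CARD('n)" and p: "p \<in> radical" "p \<noteq> 0" and u: "u \<in> radical"
  obtains c where "u = c *s p"
proof (rule ccontr)
  assume "\<not> thesis"
  then have no: "u \<noteq> c *s p" for c using that by blast
  define conj where "conj v = (\<chi> i. (v $ i) ^ q)" for v :: "'k ^ 'n"
  have conj_conj: "conj (conj v) = v" for v by (simp add: conj_def vec_eq_iff)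
  have ker: "H *v conj v = 0" if "v \<in> radical" for v
  proof -
    have "(\<Sum>j\<in>UNIV. H $ i $ j * (v $ j) ^ q) = 0" for i
    proof -
      have "herm (axis i 1) v = (\<Sum>i'\<in>UNIV. if i' = i then \<Sum>j\<in>UNIV. H $ i $ j * (v $ j) ^ q else 0)"
        unfolding herm_def by (intro sum.cong) (auto simp: axis_def)
      also have "\<dots> = (\<Sum>j\<in>UNIV. H $ i $ j * (v $ j) ^ q)"
        by simp
      finally show ?thesis
        using that herm_eq_0_sym[of v "axis i 1"] by (simp add: radical_def)
    qed
    then show ?thesis
      by (simp add: matrix_vector_mult_def conj_def vec_eq_iff)
  qed
  have "conj p \<noteq> 0"
    using conj_conj[of p] p(2) by (auto simp: conj_def vec_eq_iff)
  moreover have "conj u \<noteq> c *s conj p" for c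
  proof
    assume "conj u = c *s conj p"
    then have "conj (conj u) = conj (c *s conj p)" by simp
    also have "\<dots> = (c ^ q) *s conj (conj p)"
      by (simp add: conj_def vec_eq_iff power_mult_distrib)
    finally show False using no by (simp add: conj_conj)
  qed
  ultimately show False
    using rank_le_of_kernel[OF ker[OF u] ker[OF p(1)]] rank by fastforce
qed

end

section \<open>Normal form of a Hermitian form of rank 3\<close>

locale hermitian_cone = hermitian_form q K H
  for q :: nat and K :: "'k::{field,finite} itself" and H :: "'k ^ 4 ^ 4" +
  fixes p :: "'k ^ 4"
  assumes rank_H: "rank H = 3" and p_radical: "p \<in> radical" and p_nonzero: "p \<noteq> 0"
begin

lemma herm_p [simp]: "herm p v = 0" "herm v p = 0"
  using p_radical herm_eq_0_sym by (auto simp: radical_def)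

text \<open>A dimension count, with \<open>P\<close> to be read as membership in an orthogonal
  complement: were that complement inside the radical, which is the line of p, three vectors would
  span a 4-dimensional space.\<close>

lemma nonradical_in_complement:
  assumes "\<And>v. \<exists>v' a b. P v' \<and> v = v' + a *s e + b *s f"
  obtains v where "P v" "v \<notin> radical"
proof (rule ccontr)
  assume "\<not> thesis"
  then have rad: "\<forall>v. P v \<longrightarrow> v \<in> radical" using that by blast
  have "v \<in> vec.span {p, e, f}" for v
  proof -
    obtain v' a b where v: "P v'" "v = v' + a *s e + b *s f" using assms by blast
    then obtain c where v': "v' = c *s p"
      using radical_multiple[of p v'] p_radical p_nonzero rad rank_H by auto
    then show ?thesis
      unfolding v(2) v' by (intro vec.span_add vec.span_scale vec.span_base) auto
  qed
  then have "vec.dim (UNIV :: ('k ^ 4) set) \<le> card {p, e, f}"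
    by (intro vec.dim_le_card) auto
  also have "\<dots> \<le> 3" by (simp add: card_insert_if)
  finally show False unfolding vec_dim_card by simp
qed

lemma hyperbolic_pair:
  obtains e1 e2 where "herm e1 e1 = 0" "herm e2 e2 = 0" "herm e1 e2 = 1" "herm e2 e1 = 1"
proof -
  obtain v0 where "v0 \<notin> radical"
    by (rule nonradical_in_complement[of "\<lambda>_. True" 0 0]) auto
  then obtain w0 where "herm v0 w0 \<noteq> 0" by (auto simp: radical_def)
  then obtain u where u: "herm u u \<noteq> 0" by (rule polarization)
  have "\<exists>v' a b. herm v' u = 0 \<and> v = v' + a *s u + b *s 0" for v
    by (intro exI[of _ "v - (herm v u / herm u u) *s u"] exI[of _ "herm v u / herm u u"])
      (simp add: u)
  then obtain v where v: "herm v u = 0" "v \<notin> radical"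
    by (rule nonradical_in_complement)
  obtain e1 where e1: "herm e1 e1 = 0" "e1 \<notin> radical"
  proof (cases "herm v v = 0")
    case True
    then show ?thesis using v that by blast
  next
    case False
    \<comment> \<open>Two orthogonal anisotropic vectors span an isotropic one, since the required
      scalar solves a norm equation.\<close>
    have "(- herm v v / herm u u) ^ q = - herm v v / herm u u"
      by (simp add: power_divide frob_minus herm_self_fixed)
    then obtain t where t: "t ^ (q + 1) = - herm v v / herm u u" "t \<noteq> 0"
      by (rule norm_surj) (use False u in auto)
    have "herm (v + t *s u) (v + t *s u) = herm v v + t ^ (q + 1) * herm u u"
      using v(1) herm_eq_0_sym[OF v(1)] by simp
    also have "\<dots> = 0" using u by (simp only: t) simp
    finally have "herm (v + t *s u) (v + t *s u) = 0" .
    moreover have "herm (v + t *s u) u \<noteq> 0" using v(1) u t by simp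
    ultimately show ?thesis using that by (auto simp only: radical_def mem_Collect_eq)
  qed
  then obtain w where w: "herm e1 w \<noteq> 0" by (auto simp: radical_def)
  obtain c where c: "herm (w + c *s e1) (w + c *s e1) = 0"
    by (rule isotropic_adjust[OF e1(1) w])
  \<comment> \<open>The power q compensates for semilinearity in the second argument, where the
    scalar is raised to the power q once more.\<close>
  define e2 where "e2 = inverse (herm e1 w) ^ q *s (w + c *s e1)"
  have "herm e2 e2 = 0" unfolding e2_def herm_scale_left herm_scale_right c by simp
  moreover have "herm e1 e2 = 1" using w e1(1) by (simp add: e2_def)
  moreover from this have "herm e2 e1 = 1" by (simp add: herm_sym[of e2 e1])
  ultimately show ?thesis using that e1(1) by blast
qed

definition frame :: "'k ^ 4 \<Rightarrow> 'k ^ 4 \<Rightarrow> 'k ^ 4 \<Rightarrow> 'k \<Rightarrow> 'k \<Rightarrow> 'k \<Rightarrow> 'k \<Rightarrow> 'k ^ 4" where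
  "frame e0 e1 e2 x y z t = x *s e0 + y *s e1 + z *s e2 + t *s p"

text \<open>The complement of a hyperbolic pair contains a vector outside the radical, hence by
  polarization an anisotropic \<open>e0\<close>. With p as last basis vector, the coordinate t runs
  along the generators and does not occur in the form.\<close>

lemma normal_form:
  obtains e0 e1 e2 \<eta> where "\<eta> \<noteq> 0" "\<eta> ^ q = \<eta>"
    "\<And>v. \<exists>x y z t. v = frame e0 e1 e2 x y z t"
    "\<And>x y z t x' y' z' t'. frame e0 e1 e2 x y z t = frame e0 e1 e2 x' y' z' t' \<Longrightarrow>
      x = x' \<and> y = y' \<and> z = z' \<and> t = t'"
    "\<And>x y z t x' y' z' t'. herm (frame e0 e1 e2 x y z t) (frame e0 e1 e2 x' y' z' t') =
      \<eta> * x * x' ^ q + y * z' ^ q + z * y' ^ q"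
proof -
  obtain e1 e2 where e: "herm e1 e1 = 0" "herm e2 e2 = 0" "herm e1 e2 = 1" "herm e2 e1 = 1"
    by (rule hyperbolic_pair)
  let ?C = "\<lambda>v. herm v e1 = 0 \<and> herm v e2 = 0"
  have decomp: "?C (v - herm v e2 *s e1 - herm v e1 *s e2)" for v
    using e by simp
  have "\<exists>v' a b. ?C v' \<and> v = v' + a *s e1 + b *s e2" for v
    using decomp[of v]
    by (intro exI[of _ "v - herm v e2 *s e1 - herm v e1 *s e2"] exI[of _ "herm v e2"]
        exI[of _ "herm v e1"]) simp
  then obtain f where f: "?C f" "f \<notin> radical"
    by (rule nonradical_in_complement)
  then obtain w where w: "herm f w \<noteq> 0" by (auto simp: radical_def)
  \<comment> \<open>Projecting w into the complement keeps its product with f, as f is orthogonal to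
    the pair.\<close>
  define w' where "w' = w - herm w e2 *s e1 - herm w e1 *s e2"
  have "?C w'" unfolding w'_def by (rule decomp)
  have "herm f w' \<noteq> 0" using f w by (simp add: w'_def)
  then obtain a b where ab: "herm (a *s f + b *s w') (a *s f + b *s w') \<noteq> 0"
    by (rule polarization)
  define e0 where "e0 = a *s f + b *s w'"
  define \<eta> where "\<eta> = herm e0 e0"
  have "?C e0" using f \<open>?C w'\<close> by (simp add: e0_def)
  then have e0: "herm e0 e1 = 0" "herm e0 e2 = 0" "herm e1 e0 = 0" "herm e2 e0 = 0"
    using herm_eq_0_sym by blast+
  have \<eta>: "\<eta> \<noteq> 0" "\<eta> ^ q = \<eta>"
    using ab by (auto simp: \<eta>_def e0_def[symmetric] herm_self_fixed)
  have herm_frame: "herm (frame e0 e1 e2 x y z t) (frame e0 e1 e2 x' y' z' t') =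
      \<eta> * x * x' ^ q + y * z' ^ q + z * y' ^ q" for x y z t x' y' z' t'
    using e e0 by (simp add: frame_def \<eta>_def[symmetric] algebra_simps)
  have coords: "herm (frame e0 e1 e2 x y z t) e0 = \<eta> * x"
    "herm (frame e0 e1 e2 x y z t) e2 = y" "herm (frame e0 e1 e2 x y z t) e1 = z" for x y z t
    using e e0 by (simp_all add: frame_def \<eta>_def[symmetric])
  have inj: "x = x' \<and> y = y' \<and> z = z' \<and> t = t'"
    if eq: "frame e0 e1 e2 x y z t = frame e0 e1 e2 x' y' z' t'" for x y z t x' y' z' t'
  proof -
    have *: "x = x'" "y = y'" "z = z'"
      using coords[of x y z t] coords[of x' y' z' t'] \<eta>(1) unfolding eq by auto
    then have "t *s p = t' *s p" using eq by (simp add: frame_def)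
    then show ?thesis using * p_nonzero by simp
  qed
  let ?\<phi> = "\<lambda>(x, y, z, t). frame e0 e1 e2 x y z t"
  \<comment> \<open>Between finite sets of equal size, injectivity of the coordinates gives
    surjectivity.\<close>
  have "inj ?\<phi>" using inj by (auto simp: inj_on_def)
  then have "card (range ?\<phi>) = CARD('k \<times> 'k \<times> 'k \<times> 'k)" by (rule card_image)
  also have "\<dots> = CARD('k ^ 4)" by (simp add: power_numeral_reduce)
  finally have "range ?\<phi> = UNIV" by (intro card_subset_eq) auto
  then have surj: "\<exists>x y z t. v = frame e0 e1 e2 x y z t" for v
    using surjD[of ?\<phi> v] by auto
  show ?thesis
    by (rule that[OF \<eta> surj inj herm_frame])
qed

end

subsection \<open>Rational points and rational lines\<close>

lemma to_ac_vec_nth [simp]: "to_ac_vec v $ i = to_ac (v $ i)"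
  by (simp add: to_ac_vec_def)

lemma to_ac_vec_add: "to_ac_vec (u + v) = to_ac_vec u + to_ac_vec v"
  by (simp add: vec_eq_iff)

lemma to_ac_vec_scale: "to_ac_vec (c *s v) = to_ac c *s to_ac_vec v"
  by (simp add: vec_eq_iff)

lemma to_ac_vec_eq_iff [simp]: "to_ac_vec u = to_ac_vec v \<longleftrightarrow> u = v"
  by (simp add: vec_eq_iff)

lemma to_ac_vec_eq_0_iff [simp]: "to_ac_vec v = 0 \<longleftrightarrow> v = 0"
  by (simp add: vec_eq_iff)

lemma rational_vectors_eq:
  "(rational_vectors :: ('k::field, 'n::finite) geom_vec set) = range to_ac_vec"
proof (intro subset_antisym subsetI)
  fix x :: "('k::field, 'n::finite) geom_vec"
  assume "x \<in> rational_vectors"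
  then have "x $ i \<in> range to_ac" for i
    by (auto simp: rational_vectors_def)
  then have "x = to_ac_vec (\<chi> i. of_ac (x $ i))"
    by (simp add: vec_eq_iff to_ac_of_ac)
  then show "x \<in> range to_ac_vec" by (rule range_eqI)
qed (auto simp: rational_vectors_def)

lemma proj_point_scale:
  assumes "c \<noteq> 0"
  shows "proj_point (c *s x) = proj_point x"
proof (intro subset_antisym subsetI)
  fix z assume "z \<in> proj_point (c *s x)"
  then obtain a where "z = (a * c) *s x" "a \<noteq> 0"
    by (auto simp: proj_point_def)
  then show "z \<in> proj_point x"
    using assms unfolding proj_point_def by (intro CollectI exI[of _ "a * c"]) simp
next
  fix z assume "z \<in> proj_point x"
  then obtain a where "z = a *s x" "a \<noteq> 0"
    by (auto simp: proj_point_def)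
  then show "z \<in> proj_point (c *s x)"
    using assms unfolding proj_point_def by (intro CollectI exI[of _ "a / c"]) simp
qed

lemma proj_point_self: "x \<in> proj_point x"
  unfolding proj_point_def by (simp, rule exI[of _ 1]) simp

lemma proj_point_eq_iff: "proj_point x = proj_point y \<longleftrightarrow> (\<exists>c. c \<noteq> 0 \<and> x = c *s y)"
proof
  assume "proj_point x = proj_point y"
  then have "x \<in> proj_point y" using proj_point_self by metis
  then show "\<exists>c. c \<noteq> 0 \<and> x = c *s y" by (auto simp: proj_point_def)
qed (auto simp: proj_point_scale)

lemma proj_point_in_projectivization_iff:
  assumes "x \<noteq> 0" "\<And>c x. c \<noteq> 0 \<Longrightarrow> x \<in> W \<Longrightarrow> c *s x \<in> W"
  shows "proj_point x \<in> projectivization W \<longleftrightarrow> x \<in> W"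
proof
  assume "proj_point x \<in> projectivization W"
  then obtain y where "y \<in> W" "proj_point x = proj_point y"
    by (auto simp: projectivization_def)
  then show "x \<in> W" using assms(2) by (auto simp: proj_point_eq_iff)
qed (use assms in \<open>auto simp: projectivization_def\<close>)

definition rat_pt :: "'k::field ^ 'n \<Rightarrow> ('k, 'n::finite) proj_pt" where
  "rat_pt v = proj_point (to_ac_vec v)"

text \<open>A coordinate where v is nonzero exhibits the scalar as a quotient of elements of the
  base field.\<close>

lemma to_ac_vec_eq_scaleD:
  assumes "to_ac_vec u = c *s to_ac_vec v" "v \<noteq> 0"
  obtains c' where "c = to_ac c'" "u = c' *s v"
proof -
  obtain i where i: "v $ i \<noteq> 0" using assms(2) by (auto simp: vec_eq_iff)
  have "to_ac (u $ i) = c * to_ac (v $ i)"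
    using assms(1) by (simp add: vec_eq_iff)
  then have c: "c = to_ac (u $ i / v $ i)" using i by simp
  then have "to_ac_vec u = to_ac_vec ((u $ i / v $ i) *s v)"
    using assms(1) by (simp only: to_ac_vec_scale)
  then have "u = (u $ i / v $ i) *s v"
    by (simp only: to_ac_vec_eq_iff)
  then show ?thesis by (rule that[OF c])
qed

lemma rat_pt_eq_iff:
  assumes "v \<noteq> 0"
  shows "rat_pt u = rat_pt v \<longleftrightarrow> (\<exists>c. c \<noteq> 0 \<and> u = c *s v)"
proof
  assume "rat_pt u = rat_pt v"
  then obtain c where c: "c \<noteq> 0" "to_ac_vec u = c *s to_ac_vec v"
    by (auto simp: rat_pt_def proj_point_eq_iff)
  obtain c' where "c = to_ac c'" "u = c' *s v"
    by (rule to_ac_vec_eq_scaleD[OF c(2) assms])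
  then show "\<exists>c. c \<noteq> 0 \<and> u = c *s v" using c by auto
next
  assume "\<exists>c. c \<noteq> 0 \<and> u = c *s v"
  then show "rat_pt u = rat_pt v"
    by (auto simp: rat_pt_def to_ac_vec_scale proj_point_scale)
qed

lemma rational_points_eq:
  "rational_points A = {rat_pt v | v. v \<noteq> 0 \<and> rat_pt v \<in> A}"
proof (intro subset_antisym subsetI)
  fix Q assume "Q \<in> rational_points A"
  then obtain x where "Q = proj_point x" "x \<in> rational_vectors" "x \<noteq> 0" "Q \<in> A"
    unfolding rational_points_def projectivization_def by blast
  moreover from this obtain v where "x = to_ac_vec v"
    unfolding rational_vectors_eq by blast
  ultimately have "Q = rat_pt v" "v \<noteq> 0" "rat_pt v \<in> A"
    by (simp_all add: rat_pt_def)
  then show "Q \<in> {rat_pt v | v. v \<noteq> 0 \<and> rat_pt v \<in> A}" by blast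
next
  fix Q assume "Q \<in> {rat_pt v | v. v \<noteq> 0 \<and> rat_pt v \<in> A}"
  then obtain v where v: "Q = rat_pt v" "v \<noteq> 0" "Q \<in> A" by blast
  then have "to_ac_vec v \<in> rational_vectors" "to_ac_vec v \<noteq> 0"
    by (simp_all add: rational_vectors_eq)
  then show "Q \<in> rational_points A"
    using v(1,3) unfolding rational_points_def projectivization_def rat_pt_def by blast
qed

section \<open>Lines spanned by two rational vectors\<close>

definition independent_pair :: "'k::field ^ 'n \<Rightarrow> 'k ^ 'n \<Rightarrow> bool" where
  "independent_pair u w \<longleftrightarrow> w \<noteq> 0 \<and> (\<forall>c. u \<noteq> c *s w)"

definition plane :: "'k::field ^ 'n \<Rightarrow> 'k ^ 'n \<Rightarrow> ('k, 'n::finite) geom_vec set" where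
  "plane u w = vec.span {to_ac_vec u, to_ac_vec w}"

lemma in_plane_iff: "x \<in> plane u w \<longleftrightarrow> (\<exists>a b. x = a *s to_ac_vec u + b *s to_ac_vec w)"
  unfolding plane_def vec.span_insert vec.span_singleton
  by (auto simp: diff_eq_eq add.commute)

lemma to_ac_vec_in_plane: "to_ac_vec (a *s u + b *s w) \<in> plane u w"
  unfolding in_plane_iff to_ac_vec_add to_ac_vec_scale by blast

lemma plane_pair:
  assumes "independent_pair u w"
  shows "vec.independent {to_ac_vec u, to_ac_vec w}" "card {to_ac_vec u, to_ac_vec w} = 2"
proof -
  have "to_ac_vec u \<noteq> c *s to_ac_vec w" for c
    using assms to_ac_vec_eq_scaleD[of u c w] by (metis independent_pair_def)
  then have "to_ac_vec u \<notin> vec.span {to_ac_vec w}"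
    by (auto simp: vec.span_singleton)
  moreover have "vec.independent {to_ac_vec w}"
    using assms by (simp add: independent_pair_def)
  ultimately show "vec.independent {to_ac_vec u, to_ac_vec w}"
    by (rule vec.independent_insertI)
  have "u \<noteq> w" using assms by (metis independent_pair_def vec.scale_one)
  then show "card {to_ac_vec u, to_ac_vec w} = 2" by simp
qed

lemma subspace_plane: "vec.subspace (plane u w)"
  unfolding plane_def by (rule vec.subspace_span)

lemma dim_plane:
  assumes "independent_pair u w"
  shows "vec.dim (plane u w) = 2"
  using plane_pair[OF assms] by (simp add: plane_def vec.dim_eq_card_independent)

lemma plane_eqI:
  assumes "vec.subspace W" "vec.dim W = 2" "to_ac_vec u \<in> W" "to_ac_vec w \<in> W"
    and "independent_pair u w"
  shows "W = plane u w"
proof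
  show "W \<subseteq> plane u w"
    unfolding plane_def using assms plane_pair[OF assms(5)]
    by (intro vec.card_ge_dim_independent) auto
  show "plane u w \<subseteq> W"
    unfolding plane_def using assms by (intro vec.span_minimal) auto
qed

lemma is_rational_line_plane:
  assumes "independent_pair u w"
  shows "is_rational_line (projectivization (plane u w))"
proof -
  have "vec.span (plane u w \<inter> rational_vectors) = plane u w"
  proof
    show "vec.span (plane u w \<inter> rational_vectors) \<subseteq> plane u w"
      by (intro vec.span_minimal subspace_plane) simp
    have "{to_ac_vec u, to_ac_vec w} \<subseteq> plane u w \<inter> rational_vectors"
      by (auto simp: plane_def rational_vectors_eq intro: vec.span_base)
    then show "plane u w \<subseteq> vec.span (plane u w \<inter> rational_vectors)"
      using vec.span_mono by (metis plane_def)
  qed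
  then show ?thesis
    unfolding is_rational_line_def using subspace_plane dim_plane[OF assms] by blast
qed

lemma is_line_plane:
  assumes "independent_pair u w"
  shows "is_line (projectivization (plane u w))"
  unfolding is_line_def using subspace_plane dim_plane[OF assms] by blast

text \<open>A basis of the span can be chosen inside any spanning set, here among the rational
  vectors.\<close>

lemma rational_lineE:
  assumes "is_rational_line L"
  obtains u w where "independent_pair u w" "L = projectivization (plane u w)"
proof -
  obtain W where W: "vec.subspace W" "vec.dim W = 2" "vec.span (W \<inter> rational_vectors) = W"
    "L = projectivization W"
    using assms unfolding is_rational_line_def by (elim exE conjE)
  obtain B where B: "B \<subseteq> W \<inter> rational_vectors" "vec.independent B"
    "W \<inter> rational_vectors \<subseteq> vec.span B" "card B = vec.dim (W \<inter> rational_vectors)"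
    by (rule vec.basis_exists)
  have "card B = 2"
    using B(4) W(2) vec.dim_span[of "W \<inter> rational_vectors"] W(3) by simp
  then obtain x y where xy: "B = {x, y}" "x \<noteq> y" by (auto simp: card_2_iff)
  have "x \<in> range to_ac_vec" "y \<in> range to_ac_vec"
    using B(1) xy(1) by (auto simp: rational_vectors_eq)
  then obtain u w where uw: "x = to_ac_vec u" "y = to_ac_vec w" by (elim imageE)
  have "independent_pair u w"
  proof -
    have "y \<noteq> 0" "x \<notin> vec.span {y}"
      using B(2) xy vec.dependent_zero[of B] vec.independent_insert[of x "{y}"] by auto
    then show ?thesis
      unfolding independent_pair_def uw by (auto simp: vec.span_singleton to_ac_vec_scale)
  qed
  moreover from this have "W = plane u w"
    using W(1,2) B(1) xy uw by (intro plane_eqI) auto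
  ultimately show ?thesis using that W(4) by simp
qed

text \<open>A rational vector that is a combination of two rational vectors over the closure is
  already one over the base field.\<close>

lemma rat_pt_in_plane_iff:
  assumes "v \<noteq> 0" "independent_pair u w"
  shows "rat_pt v \<in> projectivization (plane u w) \<longleftrightarrow> (\<exists>a b. v = a *s u + b *s w)"
proof -
  have "rat_pt v \<in> projectivization (plane u w) \<longleftrightarrow> to_ac_vec v \<in> plane u w"
    unfolding rat_pt_def using assms vec.subspace_scale[OF subspace_plane]
    by (intro proj_point_in_projectivization_iff) auto
  also have "\<dots> \<longleftrightarrow> (\<exists>a b. v = a *s u + b *s w)"
  proof
    assume "to_ac_vec v \<in> plane u w"
    then obtain a b where ab: "to_ac_vec v = a *s to_ac_vec u + b *s to_ac_vec w"
      by (auto simp: in_plane_iff)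
    have "w \<noteq> 0" using assms(2) by (simp add: independent_pair_def)
    then obtain i where i: "w $ i \<noteq> 0" by (auto simp: vec_eq_iff)
    \<comment> \<open>Eliminating w at a coordinate where it is nonzero reduces the claim to a
      proportionality of two rational vectors.\<close>
    define u' where "u' = u - (u $ i / w $ i) *s w"
    define v' where "v' = v - (v $ i / w $ i) *s w"
    have "u' \<noteq> 0" using assms(2) by (auto simp: u'_def independent_pair_def)
    have "to_ac_vec v' = a *s to_ac_vec u'"
    proof (simp only: vec_eq_iff, intro allI)
      fix j
      have *: "to_ac (v $ j) = a * to_ac (u $ j) + b * to_ac (w $ j)" for j
        using ab by (simp add: vec_eq_iff)
      have r: "to_ac (v $ i / w $ i) = a * to_ac (u $ i / w $ i) + b"
        using i by (simp add: *[of i] add_divide_distrib)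
      have "a * U + b * W - (a * R + b) * W = a * (U - R * W)" for U W R
        by (simp add: algebra_simps)
      from this[of "to_ac (u $ j)" "to_ac (w $ j)" "to_ac (u $ i / w $ i)"]
      show "to_ac_vec v' $ j = (a *s to_ac_vec u') $ j"
        unfolding u'_def v'_def to_ac_vec_nth vector_minus_component vector_smult_component
          to_ac_diff to_ac_mult r * .
    qed
    then obtain a' where "v' = a' *s u'"
      using \<open>u' \<noteq> 0\<close> by (rule to_ac_vec_eq_scaleD)
    then have "v' = a' *s u - (a' * (u $ i / w $ i)) *s w"
      by (simp add: u'_def vec.scale_right_diff_distrib)
    moreover have "v = v' + (v $ i / w $ i) *s w"
      by (simp add: v'_def)
    ultimately have "v = a' *s u + (v $ i / w $ i - a' * (u $ i / w $ i)) *s w"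
      unfolding vec.scale_left_diff_distrib by (simp only: add_diff_eq diff_add_eq)
    then show "\<exists>a b. v = a *s u + b *s w" by blast
  next
    assume "\<exists>a b. v = a *s u + b *s w"
    then show "to_ac_vec v \<in> plane u w"
      using to_ac_vec_in_plane by blast
  qed
  finally show ?thesis .
qed

lemma plane_cong:
  assumes "independent_pair u w" "independent_pair u' w'"
    and "u' = a *s u + b *s w" "w' = a' *s u + b' *s w"
  shows "plane u w = plane u' w'"
  using assms by (intro plane_eqI subspace_plane dim_plane) (simp_all add: to_ac_vec_in_plane)

lemma rat_pt_in_zero_locus_iff:
  assumes "homogeneous d F" "v \<noteq> 0"
  shows "rat_pt v \<in> zero_locus F \<longleftrightarrow> poly_fun F v = 0"
proof -
  have "eval_poly F (c *s x) = c ^ d * eval_poly F x" for c x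
    unfolding eval_poly_def sum_distrib_left
  proof (intro sum.cong refl)
    fix m assume "m \<in> Poly_Mapping.keys F"
    then have "d = (\<Sum>i\<in>UNIV. Poly_Mapping.lookup m i)"
      using assms(1) by (simp add: homogeneous_def)
    then have "c ^ d = (\<Prod>i\<in>UNIV. c ^ Poly_Mapping.lookup m i)"
      by (simp only: power_sum)
    then show "to_ac (Poly_Mapping.lookup F m) * (\<Prod>i\<in>UNIV. ((c *s x) $ i) ^ Poly_Mapping.lookup m i) =
        c ^ d * (to_ac (Poly_Mapping.lookup F m) * (\<Prod>i\<in>UNIV. (x $ i) ^ Poly_Mapping.lookup m i))"
      by (simp only: vector_smult_component power_mult_distrib prod.distrib mult.left_commute)
  qed
  then have "rat_pt v \<in> zero_locus F \<longleftrightarrow> to_ac_vec v \<in> {x. eval_poly F x = 0}"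
    unfolding rat_pt_def zero_locus_def using assms(2)
    by (intro proj_point_in_projectivization_iff) auto
  then show ?thesis by (simp add: eval_poly_to_ac_vec)
qed

lemma (in hermitian_form) rat_pt_in_hermitian_variety_iff:
  assumes "v \<noteq> 0"
  shows "rat_pt v \<in> hermitian_variety q H \<longleftrightarrow> herm v v = 0"
proof -
  define h where "h x = (\<Sum>i\<in>UNIV. \<Sum>j\<in>UNIV. to_ac (H $ i $ j) * x $ i * (x $ j) ^ q)"
    for x :: "('k, 'n) geom_vec"
  have "h (c *s x) = c * c ^ q * h x" for c x
    unfolding h_def sum_distrib_left
    by (intro sum.cong refl) (simp add: power_mult_distrib mult_ac)
  then have "rat_pt v \<in> hermitian_variety q H \<longleftrightarrow> to_ac_vec v \<in> {x. h x = 0}"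
    unfolding rat_pt_def hermitian_variety_def h_def[symmetric] using assms
    by (intro proj_point_in_projectivization_iff) auto
  moreover have "h (to_ac_vec v) = to_ac (herm v v)"
    by (simp add: h_def herm_def to_ac_sum)
  ultimately show ?thesis by simp
qed

subsection \<open>Sections of the cone\<close>

context hermitian_curve
begin

text \<open>Normalized coordinate triples of the rational points of the projective curve; the first is its
  point at infinity.\<close>

definition base_points :: "('k \<times> 'k \<times> 'k) set" where
  "base_points = insert (0, 1, 0) ((\<lambda>(x, y). (x, y, 1)) ` curve)"

lemma inj_affine_point: "inj_on (\<lambda>(x, y). (x, y, 1 :: 'k)) A"
  by (auto simp: inj_on_def)

lemma card_base_points: "card base_points = q ^ 3 + 1"
proof -
  have "(0, 1, 0) \<notin> (\<lambda>(x, y). (x, y, 1 :: 'k)) ` curve" by auto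
  then show ?thesis
    by (simp add: base_points_def card_image[OF inj_affine_point] card_curve)
qed

lemma sum_pairs_single:
  assumes "(a :: nat) + b \<le> k" "\<And>p. fst p + snd p \<le> k \<Longrightarrow> p \<noteq> (a, b) \<Longrightarrow> f p = 0"
  shows "(\<Sum>p | fst p + snd p \<le> k. f p) = (f (a, b) :: 'k)"
proof -
  have "finite {p :: nat \<times> nat. fst p + snd p \<le> k}"
    by (rule finite_subset[of _ "{..k} \<times> {..k}"]) auto
  then have "(\<Sum>p | fst p + snd p \<le> k. f p) = (\<Sum>p\<in>{(a, b)}. f p)"
    using assms by (intro sum.mono_neutral_right) auto
  then show ?thesis by simp
qed

text \<open>In the cardinality assumption the first summand is the vertex and the sum collects the
  remaining points generator by generator. For m = 0 every fibre is empty or full, so the count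
  forces |Z| = d (q + 1).\<close>

lemma cone_section:
  fixes c :: "nat \<times> nat \<times> nat \<Rightarrow> 'k" and d :: nat
  defines "g \<equiv> \<lambda>x y z t. \<Sum>(a, b, s)\<in>triples d. c (a, b, s) * (x ^ a * y ^ b * z ^ (d - a - b - s) * t ^ s)"
  assumes d: "1 \<le> d" "d \<le> q" and nonzero: "\<exists>p\<in>triples d. c p \<noteq> 0"
    and card: "(if g 0 0 0 1 = 0 then 1 else 0) +
      (\<Sum>(x, y, z)\<in>base_points. card {t. g x y z t = 0}) = 1 + q\<^sup>2 * d * (q + 1)"
  obtains S where "S \<subseteq> base_points" "card S = d * (q + 1)" "g 0 0 0 1 = 0"
    "\<And>x y z t. (x, y, z) \<in> base_points \<Longrightarrow> g x y z t = 0 \<longleftrightarrow> (x, y, z) \<in> S"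
proof -
  define m where "m = Max ((\<lambda>(a, b, s). s) ` {p \<in> triples d. c p \<noteq> 0})"
  have fin: "finite {p \<in> triples d. c p \<noteq> 0}" by simp
  have "m \<in> (\<lambda>(a, b, s). s) ` {p \<in> triples d. c p \<noteq> 0}"
    unfolding m_def using nonzero by (intro Max_in finite_imageI fin) auto
  then obtain a0 b0 where ab0: "(a0, b0, m) \<in> triples d" "c (a0, b0, m) \<noteq> 0"
    by auto
  have m_max: "c (a, b, s) = 0" if "(a, b, s) \<in> triples d" "m < s" for a b s
  proof (rule ccontr)
    assume "c (a, b, s) \<noteq> 0"
    then have "s \<in> (\<lambda>(a, b, s). s) ` {p \<in> triples d. c p \<noteq> 0}"
      using that(1) by (intro image_eqI[of _ _ "(a, b, s)"]) auto
    then have "s \<le> m"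
      unfolding m_def by (intro Max_ge finite_imageI fin)
    then show False using that(2) by simp
  qed
  have "m \<le> d" using ab0 by (auto simp: triples_def)
  define k where "k = d - m"
  define G where "G s x y z = (\<Sum>p | fst p + snd p \<le> d - s.
      c (fst p, snd p, s) * (x ^ fst p * y ^ snd p * z ^ (d - s - fst p - snd p)))" for s x y z
  have g_eq: "g x y z t = (\<Sum>s<m + 1. G s x y z * t ^ s)" for x y z t
  proof -
    define h where "h = (\<lambda>(a, b, s). c (a, b, s) * (x ^ a * y ^ b * z ^ (d - a - b - s) * t ^ s))"
    have "g x y z t = (\<Sum>s\<in>{..d}. \<Sum>p\<in>{p \<in> triples d. snd (snd p) = s}. h p)"
      unfolding g_def h_def by (rule sum.group[symmetric]) (simp, simp, auto simp: triples_def)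
    also have "\<dots> = (\<Sum>s\<in>{..d}. G s x y z * t ^ s)"
    proof (rule sum.cong[OF refl])
      fix s assume "s \<in> {..d}"
      have "(\<Sum>p\<in>{p \<in> triples d. snd (snd p) = s}. h p) =
          (\<Sum>p | fst p + snd p \<le> d - s. h (fst p, snd p, s))"
        by (rule sum.reindex_bij_witness[of _ "\<lambda>p. (fst p, snd p, s)" "\<lambda>p. (fst p, fst (snd p))"])
          (use \<open>s \<in> {..d}\<close> in \<open>auto simp: triples_def\<close>)
      also have "\<dots> = G s x y z * t ^ s"
        unfolding G_def h_def sum_distrib_right
        by (intro sum.cong refl) (simp add: diff_diff_left add.commute add.left_commute mult.assoc)
      finally show "(\<Sum>p\<in>{p \<in> triples d. snd (snd p) = s}. h p) = G s x y z * t ^ s" .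
    qed
    also have "\<dots> = (\<Sum>s<m + 1. G s x y z * t ^ s)"
    proof (rule sum.mono_neutral_right)
      show "\<forall>s\<in>{..d} - {..<m + 1}. G s x y z * t ^ s = 0"
      proof
        fix s assume s: "s \<in> {..d} - {..<m + 1}"
        then have "c (fst p, snd p, s) = 0" if "fst p + snd p \<le> d - s" for p
          using that by (intro m_max) (auto simp: triples_def)
        then show "G s x y z * t ^ s = 0" by (simp add: G_def)
      qed
    qed (use \<open>m \<le> d\<close> in auto)
    finally show ?thesis .
  qed
  \<comment> \<open>Off \<open>Z\<close> the polynomial in t has degree exactly \<open>m\<close>; on
    \<open>Z\<close> only the trivial bound q^2 is used.\<close>
  define Z where "Z = {(x, y, z) \<in> base_points. G m x y z = 0}"
  have card_Z: "card Z \<le> k * (q + 1)"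
  proof -
    let ?A = "{(x, y) \<in> curve. (\<Sum>(a, b) | a + b \<le> k. c (a, b, m) * x ^ a * y ^ b) = 0}"
    \<comment> \<open>At infinity only y^k survives, which is what the correction term of the curve
      bound tests.\<close>
    have inf: "G m 0 1 0 = c (0, k, m)"
    proof -
      let ?f = "\<lambda>p. c (fst p, snd p, m) * (0 ^ fst p * 1 ^ snd p * 0 ^ (d - m - fst p - snd p))"
      have "?f p = 0" if p: "fst p + snd p \<le> d - m" "p \<noteq> (0, k)" for p
      proof (cases "fst p = 0")
        case True
        then have "snd p \<noteq> k" using p(2) by (simp add: prod_eq_iff)
        then have "0 < d - m - fst p - snd p" using True p(1) by (simp add: k_def)
        then show ?thesis by simp
      qed simp
      then have "(\<Sum>p | fst p + snd p \<le> d - m. ?f p) = ?f (0, k)"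
        by (intro sum_pairs_single) (simp_all add: k_def)
      then show ?thesis by (simp add: G_def k_def)
    qed
    have aff: "G m x y 1 = (\<Sum>(a, b) | a + b \<le> k. c (a, b, m) * x ^ a * y ^ b)" for x y
      unfolding G_def k_def by (intro sum.cong) (auto simp: case_prod_beta mult.assoc)
    have "Z \<subseteq> (\<lambda>(x, y). (x, y, 1)) ` ?A \<union> (if c (0, k, m) = 0 then {(0, 1, 0)} else {})"
      using inf aff by (auto simp: Z_def base_points_def)
    then have "card Z \<le> card ((\<lambda>(x, y). (x, y, 1 :: 'k)) ` ?A \<union> (if c (0, k, m) = 0 then {(0, 1, 0)} else {}))"
      by (intro card_mono) auto
    also have "\<dots> \<le> card ((\<lambda>(x, y). (x, y, 1 :: 'k)) ` ?A) + (if c (0, k, m) = 0 then 1 else 0)"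
      by (rule order_trans[OF card_Un_le]) auto
    also have "\<dots> = card ?A + (if c (0, k, m) = 0 then 1 else 0)"
      by (simp only: card_image[OF inj_affine_point])
    also have "\<dots> \<le> k * (q + 1)"
      using d ab0 card_curve_zeros_le[of k a0 b0 "\<lambda>(a, b). c (a, b, m)"]
      by (auto simp: k_def triples_def)
    finally show ?thesis .
  qed
  have card_fibre: "card {t. g x y z t = 0} \<le> m" if "G m x y z \<noteq> 0" for x y z
  proof (rule ccontr)
    assume many: "\<not> card {t. g x y z t = 0} \<le> m"
    have "G m x y z = 0"
    proof (rule poly_function_eq_0D[of "{t. g x y z t = 0}" "m + 1" "\<lambda>s. G s x y z"])
      fix t assume "t \<in> {t. g x y z t = 0}"
      then show "(\<Sum>s<m + 1. G s x y z * t ^ s) = 0"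
        unfolding mem_Collect_eq g_eq .
    qed (use many in simp_all)
    then show False using that by simp
  qed
  have fibre_le: "card {t. g x y z t = 0} \<le> q\<^sup>2" for x y z
    using card_mono[of UNIV "{t. g x y z t = 0}"] by (simp add: card_K)
  have Z_sub: "Z \<subseteq> base_points" by (auto simp: Z_def)
  have fin_base: "finite base_points" by simp
  have "m = 0"
  proof (rule ccontr)
    assume "m \<noteq> 0"
    have split: "(\<Sum>(x, y, z)\<in>base_points. card {t. g x y z t = 0}) =
        (\<Sum>(x, y, z)\<in>base_points - Z. card {t. g x y z t = 0}) + (\<Sum>(x, y, z)\<in>Z. card {t. g x y z t = 0})"
      by (rule sum.subset_diff[OF Z_sub fin_base])
    have "(\<Sum>(x, y, z)\<in>Z. card {t. g x y z t = 0}) \<le> (\<Sum>p\<in>Z. q\<^sup>2)"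
      by (rule sum_mono) (use fibre_le in auto)
    moreover have "(\<Sum>(x, y, z)\<in>base_points - Z. card {t. g x y z t = 0}) \<le> (\<Sum>p\<in>base_points - Z. m)"
      by (rule sum_mono) (use card_fibre in \<open>auto simp: Z_def\<close>)
    moreover have "card (base_points - Z) = q ^ 3 + 1 - card Z"
      using card_Diff_subset[of Z base_points] Z_sub card_base_points by simp
    ultimately have le: "1 + q\<^sup>2 * d * (q + 1) \<le> 1 + card Z * q\<^sup>2 + (q ^ 3 + 1 - card Z) * m"
      using card split by (simp split: if_splits)
    have "card Z \<le> q ^ 3 + 1"
      using card_mono[OF fin_base Z_sub] card_base_points by simp
    \<comment> \<open>\<open>n\<close> counts the curve points off \<open>Z\<close>, and
      \<open>l\<close> below is the slack in the curve bound. The contradiction comes from m (q^3 +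
      1) < m (q^3 + q^2).\<close>
    then obtain n where n: "q ^ 3 + 1 = card Z + n" using le_Suc_ex by blast
    obtain l where l: "k * (q + 1) = card Z + l" using le_Suc_ex[OF card_Z] by blast
    have d_eq: "d = k + m" using \<open>m \<le> d\<close> by (simp add: k_def)
    have "q\<^sup>2 * d * (q + 1) = q\<^sup>2 * (k * (q + 1)) + m * (q ^ 3 + q\<^sup>2)"
      unfolding d_eq by (simp add: power2_eq_square power3_eq_cube algebra_simps)
    also have "\<dots> = q\<^sup>2 * card Z + q\<^sup>2 * l + m * (q ^ 3 + q\<^sup>2)"
      unfolding l by (simp only: distrib_left)
    finally have eq: "q\<^sup>2 * d * (q + 1) = q\<^sup>2 * card Z + q\<^sup>2 * l + m * (q ^ 3 + q\<^sup>2)" .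
    have "m * n \<le> m * (q ^ 3 + 1)"
      using n by (intro mult_left_mono) auto
    also have "1 < q\<^sup>2"
      using q_ge_2 one_less_power[of q 2] by simp
    then have "m * (q ^ 3 + 1) < m * (q ^ 3 + q\<^sup>2)"
      using \<open>m \<noteq> 0\<close> by (intro mult_strict_left_mono) auto
    finally have "m * n < m * (q ^ 3 + q\<^sup>2)" .
    moreover have n': "q ^ 3 + 1 - card Z = n" using n by simp
    ultimately show False
      using le unfolding eq n' mult.commute[of "card Z"] mult.commute[of _ m] by linarith
  qed
  have g_G: "g x y z t = G 0 x y z" for x y z t
    by (simp add: g_eq \<open>m = 0\<close>)
  \<comment> \<open>A form of positive degree vanishes at the origin of the base coordinates, which
    is where the vertex sits.\<close>
  have "G 0 0 0 0 = 0"
    unfolding G_def using d by (intro sum.neutral) (auto simp: power_0_left)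
  then have vertex: "g 0 0 0 1 = 0" by (simp add: g_G)
  have "(\<Sum>(x, y, z)\<in>base_points. card {t. g x y z t = 0}) = (\<Sum>p\<in>base_points. if p \<in> Z then q\<^sup>2 else 0)"
    by (rule sum.cong[OF refl]) (auto simp: Z_def \<open>m = 0\<close> g_G card_K split: if_splits)
  also have "\<dots> = q\<^sup>2 * card Z"
    using Z_sub by (simp add: sum.If_cases Int_absorb1 mult.commute)
  finally have "q\<^sup>2 * card Z = q\<^sup>2 * (d * (q + 1))"
    using card vertex by (simp add: distrib_left mult.assoc)
  then have "card Z = d * (q + 1)"
    using q_ge_2 by simp
  then show ?thesis
    using that[OF Z_sub _ vertex] by (auto simp: Z_def g_G \<open>m = 0\<close>)
qed

end

subsection \<open>The cone over a Hermitian curve\<close>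

locale framed_cone = hermitian_cone q K H p
  for q :: nat and K :: "'k::{field,finite} itself" and H :: "'k ^ 4 ^ 4" and p :: "'k ^ 4" +
  fixes e0 e1 e2 :: "'k ^ 4" and \<eta> :: 'k
  assumes coeff_nonzero: "\<eta> \<noteq> 0" and coeff_fixed: "\<eta> ^ q = \<eta>"
    and frame_surj: "\<And>v. \<exists>x y z t. v = frame e0 e1 e2 x y z t"
    and frame_inj: "\<And>x y z t x' y' z' t'. frame e0 e1 e2 x y z t = frame e0 e1 e2 x' y' z' t' \<Longrightarrow>
      x = x' \<and> y = y' \<and> z = z' \<and> t = t'"
    and herm_frame: "\<And>x y z t x' y' z' t'. herm (frame e0 e1 e2 x y z t) (frame e0 e1 e2 x' y' z' t') =
      \<eta> * x * x' ^ q + y * z' ^ q + z * y' ^ q"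
begin

text \<open>At z = 1 isotropy reads \<eta> x^(q+1) + y + y^q = 0; moving the first term across
  changes the sign.\<close>

sublocale hermitian_curve q K "- \<eta>"
  by unfold_locales (simp_all add: coeff_nonzero frob_minus coeff_fixed)

definition pt :: "'k \<times> 'k \<times> 'k \<Rightarrow> 'k \<Rightarrow> 'k ^ 4" where
  "pt Q t = (case Q of (x, y, z) \<Rightarrow> frame e0 e1 e2 x y z t)"

lemma frame_vertex: "frame e0 e1 e2 0 0 0 t = t *s p"
  by (simp add: frame_def)

lemma scale_frame: "c *s frame e0 e1 e2 x y z t = frame e0 e1 e2 (c * x) (c * y) (c * z) (c * t)"
  by (simp add: frame_def vec.scale_right_distrib)

lemma pt_add: "pt Q t + s *s p = pt Q (t + s)"
  by (simp add: pt_def frame_def vec.scale_left_distrib split: prod.splits)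

lemma base_points_cases:
  assumes "Q \<in> base_points"
  obtains "Q = (0, 1, 0)" | x y where "Q = (x, y, 1)" "y ^ q + y = - \<eta> * x ^ (q + 1)"
  using assms by (auto simp: base_points_def curve_def)

lemma pt_isotropic:
  assumes "Q \<in> base_points"
  shows "herm (pt Q t) (pt Q t) = 0"
  using assms
proof (cases rule: base_points_cases)
  case 1
  then show ?thesis by (simp add: pt_def herm_frame)
next
  case (2 x y)
  have "herm (pt Q t) (pt Q t) = \<eta> * x ^ (q + 1) + (y ^ q + y)"
    by (simp add: pt_def herm_frame 2(1))
  also have "\<dots> = 0" unfolding 2(2) by simp
  finally show ?thesis .
qed

text \<open>Normalization by z, or by y when z = 0, since z = 0 forces x = 0; what is left when both
  vanish is the vertex.\<close>

lemma isotropic_cases: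
  assumes "herm v v = 0"
  obtains c where "v = c *s p" | c Q t where "c \<noteq> 0" "Q \<in> base_points" "v = c *s pt Q t"
proof -
  obtain x y z t where v: "v = frame e0 e1 e2 x y z t" using frame_surj by blast
  have eq: "\<eta> * x * x ^ q + y * z ^ q + z * y ^ q = 0"
    using assms by (simp add: v herm_frame)
  show ?thesis
  proof (cases "z = 0")
    case True
    then have "x = 0" using eq coeff_nonzero by auto
    show ?thesis
    proof (cases "y = 0")
      case True
      then have "v = t *s p" using \<open>x = 0\<close> \<open>z = 0\<close> by (simp add: v frame_vertex)
      then show ?thesis by (rule that(1))
    next
      case False
      have "v = y *s pt (0, 1, 0) (t / y)"
        using False \<open>x = 0\<close> \<open>z = 0\<close> by (simp add: v pt_def scale_frame)
      with False show ?thesis by (intro that(2)) (auto simp: base_points_def)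
    qed
  next
    case False
    have zq: "z * z ^ q \<noteq> 0" using False by simp
    have "z * z ^ q * ((y / z) ^ q + y / z) = y * z ^ q + z * y ^ q"
      using False by (simp add: power_divide distrib_left add.commute)
    also have "\<dots> = - (\<eta> * x * x ^ q)"
      using eq by (simp add: add.assoc eq_neg_iff_add_eq_0 add.commute add.left_commute)
    also have "\<dots> = z * z ^ q * (- \<eta> * (x / z) ^ (q + 1))"
      using False by (simp add: power_divide)
    finally have "(y / z) ^ q + y / z = - \<eta> * (x / z) ^ (q + 1)"
      using zq mult_left_cancel by blast
    then have "(x / z, y / z, 1) \<in> base_points"
      unfolding base_points_def curve_def
      by (intro insertI2 image_eqI[of _ _ "(x / z, y / z)"]) simp_all
    moreover have "v = z *s pt (x / z, y / z, 1) (t / z)"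
      using False by (simp add: v pt_def scale_frame)
    ultimately show ?thesis using False that(2) by blast
  qed
qed

text \<open>The representatives have z = 1, or z = 0 and y = 1, and this normalization forces c =
  1.\<close>

lemma pt_unique:
  assumes "pt Q t = c *s pt Q' t'" "Q \<in> base_points" "Q' \<in> base_points"
  shows "Q = Q' \<and> t = t'"
proof -
  obtain x y z x' y' z' where Q: "Q = (x, y, z)" "Q' = (x', y', z')"
    by (metis prod.exhaust)
  have eq: "x = c * x'" "y = c * y'" "z = c * z'" "t = c * t'"
    using frame_inj[of x y z t "c * x'" "c * y'" "c * z'" "c * t'"] assms(1)
    by (simp_all add: Q pt_def scale_frame)
  have z: "(z = 0 \<and> y = 1) \<or> z = 1" "(z' = 0 \<and> y' = 1) \<or> z' = 1"
    using assms(2,3) by (auto simp: Q base_points_def)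
  have "c = 1"
  proof (cases "z' = 1")
    case True
    then have "z = c" using eq(3) by simp
    moreover have "z \<noteq> 0"
    proof
      assume "z = 0"
      then have "y = 0" using \<open>z = c\<close> eq(2) by simp
      then show False using z(1) \<open>z = 0\<close> by simp
    qed
    ultimately show ?thesis using z(1) by simp
  next
    case False
    then have "z' = 0" "y' = 1" using z(2) by auto
    then have "z = 0" using eq(3) by simp
    then have "y = 1" using z(1) by auto
    then show ?thesis using eq(2) \<open>y' = 1\<close> by simp
  qed
  then show ?thesis using eq by (simp add: Q)
qed

lemma pt_not_multiple:
  assumes "Q \<in> base_points"
  shows "pt Q t \<noteq> c *s p"
proof
  assume "pt Q t = c *s p"
  moreover obtain x y z where Q: "Q = (x, y, z)" by (metis prod.exhaust)
  ultimately have "frame e0 e1 e2 x y z t = frame e0 e1 e2 0 0 0 c"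
    by (simp add: pt_def frame_vertex)
  then have "y = 0" "z = 0" using frame_inj by blast+
  then show False using assms by (auto simp: Q base_points_def)
qed

lemma pt_nonzero: "Q \<in> base_points \<Longrightarrow> pt Q t \<noteq> 0"
  using pt_not_multiple[of Q t 0] by simp

lemma independent_pt: "Q \<in> base_points \<Longrightarrow> independent_pair (pt Q t) p"
  by (simp add: independent_pair_def p_nonzero pt_not_multiple)

lemma rat_pt_pt_eq_iff:
  assumes "Q \<in> base_points" "Q' \<in> base_points"
  shows "rat_pt (pt Q t) = rat_pt (pt Q' t') \<longleftrightarrow> Q = Q' \<and> t = t'"
  using rat_pt_eq_iff[OF pt_nonzero[OF assms(2)]] pt_unique assms by metis

lemma rat_pt_pt_neq_vertex:
  assumes "Q \<in> base_points"
  shows "rat_pt (pt Q t) \<noteq> rat_pt p"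
  using rat_pt_eq_iff[OF p_nonzero] pt_not_multiple[OF assms] by metis

definition generator :: "'k \<times> 'k \<times> 'k \<Rightarrow> ('k, 4) proj_pt set" where
  "generator Q = projectivization (plane (pt Q 0) p)"

lemma rat_pt_scale: "c \<noteq> 0 \<Longrightarrow> rat_pt (c *s v) = rat_pt v"
  by (simp add: rat_pt_def to_ac_vec_scale proj_point_scale)

lemma rational_points_generator:
  assumes "Q \<in> base_points"
  shows "rational_points (generator Q) = insert (rat_pt p) (range (\<lambda>t. rat_pt (pt Q t)))"
proof (intro subset_antisym subsetI)
  fix R assume "R \<in> rational_points (generator Q)"
  then obtain v where v: "R = rat_pt v" "v \<noteq> 0" "rat_pt v \<in> generator Q"
    unfolding rational_points_eq by blast
  then obtain a b where ab: "v = a *s pt Q 0 + b *s p"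
    using rat_pt_in_plane_iff[OF v(2) independent_pt[OF assms]] unfolding generator_def by blast
  show "R \<in> insert (rat_pt p) (range (\<lambda>t. rat_pt (pt Q t)))"
  proof (cases "a = 0")
    case True
    then have "v = b *s p" "b \<noteq> 0" using ab v(2) by auto
    then show ?thesis by (simp add: v(1) rat_pt_scale)
  next
    case False
    have "a *s (pt Q 0 + (b / a) *s p) = v"
      using False by (simp add: ab vec.scale_right_distrib)
    then have "v = a *s pt Q (b / a)"
      by (simp add: pt_add)
    then show ?thesis using False by (simp add: v(1) rat_pt_scale)
  qed
next
  fix R assume "R \<in> insert (rat_pt p) (range (\<lambda>t. rat_pt (pt Q t)))"
  then consider "R = rat_pt p" | t where "R = rat_pt (pt Q t)" by blast
  then show "R \<in> rational_points (generator Q)"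
  proof cases
    case 1
    have "p = 0 *s pt Q 0 + 1 *s p" by simp
    then have "R \<in> generator Q"
      unfolding 1 generator_def rat_pt_in_plane_iff[OF p_nonzero independent_pt[OF assms]] by blast
    then show ?thesis using 1 p_nonzero unfolding rational_points_eq by blast
  next
    case 2
    have "pt Q t = 1 *s pt Q 0 + t *s p" using pt_add[of Q 0 t] by simp
    then have "R \<in> generator Q"
      unfolding 2 generator_def
        rat_pt_in_plane_iff[OF pt_nonzero[OF assms] independent_pt[OF assms]] by blast
    then show ?thesis using 2 pt_nonzero[OF assms] unfolding rational_points_eq by blast
  qed
qed

lemma inj_on_generator: "inj_on generator base_points"
proof (rule inj_onI)
  fix Q Q' assume Q: "Q \<in> base_points" "Q' \<in> base_points" "generator Q = generator Q'"
  have "rat_pt (pt Q 0) \<in> rational_points (generator Q')"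
    unfolding Q(3)[symmetric] rational_points_generator[OF Q(1)] by blast
  then obtain t where "rat_pt (pt Q 0) = rat_pt (pt Q' t)"
    using rational_points_generator[OF Q(2)] rat_pt_pt_neq_vertex[OF Q(1), of 0] by auto
  then show "Q = Q'" using rat_pt_pt_eq_iff Q by blast
qed

lemma inj_on_rat_pt_pt:
  assumes "B \<subseteq> base_points \<times> UNIV"
  shows "inj_on (\<lambda>(Q, t). rat_pt (pt Q t)) B"
proof (rule inj_onI)
  fix x y assume xy: "x \<in> B" "y \<in> B" "(case x of (Q, t) \<Rightarrow> rat_pt (pt Q t)) = (case y of (Q, t) \<Rightarrow> rat_pt (pt Q t))"
  obtain Q t Q' t' where eq: "x = (Q, t)" "y = (Q', t')" by (metis prod.exhaust)
  have "Q \<in> base_points" "Q' \<in> base_points" using xy(1,2) assms eq by auto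
  then show "x = y" using xy(3) rat_pt_pt_eq_iff by (simp add: eq)
qed

lemma Union_rational_points_generator:
  assumes "S \<subseteq> base_points" "S \<noteq> {}"
  shows "(\<Union>Q\<in>S. rational_points (generator Q)) =
    insert (rat_pt p) ((\<lambda>(Q, t). rat_pt (pt Q t)) ` (S \<times> UNIV))"
proof -
  have "(\<Union>Q\<in>S. rational_points (generator Q)) =
      (\<Union>Q\<in>S. insert (rat_pt p) (range (\<lambda>t. rat_pt (pt Q t))))"
    using assms(1) by (intro SUP_cong refl rational_points_generator) blast
  also have "\<dots> = insert (rat_pt p) (\<Union>Q\<in>S. range (\<lambda>t. rat_pt (pt Q t)))"
    using assms(2) by simp
  also have "(\<Union>Q\<in>S. range (\<lambda>t. rat_pt (pt Q t))) = (\<lambda>(Q, t). rat_pt (pt Q t)) ` (S \<times> UNIV)"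
    by (auto simp: image_iff)
  finally show ?thesis .
qed

lemma vertex_notin_image:
  assumes "B \<subseteq> base_points \<times> UNIV"
  shows "rat_pt p \<notin> (\<lambda>(Q, t). rat_pt (pt Q t)) ` B"
proof
  assume "rat_pt p \<in> (\<lambda>(Q, t). rat_pt (pt Q t)) ` B"
  then obtain Q t where "(Q, t) \<in> B" "rat_pt p = rat_pt (pt Q t)" by auto
  then show False using assms rat_pt_pt_neq_vertex[of Q t] by auto
qed

text \<open>Distinct generators meet only in the vertex, and each has q^2 further rational
  points.\<close>

lemma card_Union_generators:
  assumes "S \<subseteq> base_points" "S \<noteq> {}"
  shows "card (\<Union>Q\<in>S. rational_points (generator Q)) = 1 + q\<^sup>2 * card S"
proof -
  have sub: "S \<times> (UNIV :: 'k set) \<subseteq> base_points \<times> UNIV" using assms(1) by blast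
  have "finite (S \<times> (UNIV :: 'k set))" by simp
  then have "card (insert (rat_pt p) ((\<lambda>(Q, t). rat_pt (pt Q t)) ` (S \<times> UNIV))) =
      1 + card ((\<lambda>(Q, t). rat_pt (pt Q t)) ` (S \<times> UNIV))"
    using vertex_notin_image[OF sub] by (simp only: card_insert_disjoint finite_imageI plus_1_eq_Suc not_False_eq_True)
  also have "card ((\<lambda>(Q, t). rat_pt (pt Q t)) ` (S \<times> UNIV)) = card (S \<times> (UNIV :: 'k set))"
    by (rule card_image[OF inj_on_rat_pt_pt[OF sub]])
  also have "\<dots> = q\<^sup>2 * card S"
    by (simp add: card_cartesian_product card_K mult.commute)
  finally show ?thesis
    unfolding Union_rational_points_generator[OF assms] .
qed

text \<open>This is why the Hermitian curve contains no lines.\<close>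

lemma orthogonal_pt:
  assumes "Q \<in> base_points" "Q' \<in> base_points" "herm (pt Q t) (pt Q' t') = 0"
  shows "Q = Q'"
  using assms(1)
proof (cases rule: base_points_cases)
  case 1
  from assms(2) show ?thesis
  proof (cases rule: base_points_cases)
    case (2 x' y')
    then show ?thesis using assms(3) 1 by (simp add: pt_def herm_frame)
  qed (use 1 in simp)
next
  case (2 x y)
  note Q = this
  from assms(2) show ?thesis
  proof (cases rule: base_points_cases)
    case 1
    then show ?thesis using assms(3) Q by (simp add: pt_def herm_frame)
  next
    case (2 x' y')
    have orth: "\<eta> * x * x' ^ q + y + y' ^ q = 0"
      using assms(3) by (simp add: pt_def herm_frame Q(1) 2(1))
    have orth': "\<eta> * x' * x ^ q + y' + y ^ q = 0"
      using herm_eq_0_sym[OF assms(3)] by (simp add: pt_def herm_frame Q(1) 2(1))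
    have eq: "\<eta> * (x * x ^ q) + (y ^ q + y) = 0" "\<eta> * (x' * x' ^ q) + (y' ^ q + y') = 0"
      unfolding Q(2) 2(2) by simp_all
    \<comment> \<open>The right-hand side expands the form at the difference of the two vectors.
      Both have z = 1, so the difference has z = 0 and only its \<eta> term remains.\<close>
    have "\<eta> * ((x - x') * (x - x') ^ q) =
        (\<eta> * (x * x ^ q) + (y ^ q + y)) + (\<eta> * (x' * x' ^ q) + (y' ^ q + y'))
        - (\<eta> * x * x' ^ q + y + y' ^ q) - (\<eta> * x' * x ^ q + y' + y ^ q)"
      unfolding frob_diff by (simp add: algebra_simps)
    also have "\<dots> = 0" unfolding orth orth' eq by simp
    finally have "x = x'" using coeff_nonzero by auto
    have "y ^ q - y' ^ q = (\<eta> * (x * x ^ q) + (y ^ q + y)) - (\<eta> * x * x' ^ q + y + y' ^ q)"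
      unfolding \<open>x = x'\<close> by (simp add: algebra_simps)
    also have "\<dots> = 0" unfolding orth eq by simp
    finally have "(y - y') ^ q = 0" by (simp only: frob_diff)
    then have "y = y'" by simp
    then show ?thesis using \<open>x = x'\<close> by (simp add: Q(1) 2(1))
  qed
qed

text \<open>On a line in the surface the form vanishes on every rational vector, so by polarization
  two spanning vectors are orthogonal. By \<open>orthogonal_pt\<close> they cannot lie over
  different points of the curve.\<close>

lemma rational_line_is_generator:
  assumes "is_rational_line L" "L \<subseteq> hermitian_variety q H"
  shows "L \<in> generator ` base_points"
proof -
  obtain u w where uw: "independent_pair u w" "L = projectivization (plane u w)"
    by (rule rational_lineE[OF assms(1)])
  have iso: "herm (a *s u + b *s w) (a *s u + b *s w) = 0" for a b
  proof (cases "a *s u + b *s w = 0")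
    case True
    then show ?thesis by (simp only: herm_0_left)
  next
    case False
    have "rat_pt (a *s u + b *s w) \<in> L"
      unfolding uw(2) rat_pt_in_plane_iff[OF False uw(1)] by blast
    then show ?thesis using rat_pt_in_hermitian_variety_iff[OF False] assms(2) by blast
  qed
  have isotropic: "herm u u = 0" "herm w w = 0" using iso[of 1 0] iso[of 0 1] by simp_all
  have orthogonal: "herm u w = 0" using polarization[of u w] iso by metis
  \<comment> \<open>The rational vectors of the generator over Q. Multiples of p belong to all of
    them, which settles the cases where one spanning vector is the vertex.\<close>
  define comb where "comb Q v \<longleftrightarrow> (\<exists>a b. v = a *s pt Q 0 + b *s p)" for Q v
  have comb_p: "comb Q (c *s p)" for Q c
    unfolding comb_def by (intro exI[of _ 0] exI[of _ c]) simp
  have comb_pt: "comb Q (c *s pt Q t)" for Q c t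
  proof -
    have "pt Q t = pt Q 0 + t *s p" using pt_add[of Q 0 t] by simp
    then have "c *s pt Q t = c *s pt Q 0 + (c * t) *s p"
      by (simp add: vec.scale_right_distrib)
    then show ?thesis unfolding comb_def by blast
  qed
  have "\<exists>Q\<in>base_points. comb Q u \<and> comb Q w"
    using isotropic(1)
  proof (cases rule: isotropic_cases)
    case (1 c)
    note u = this
    from isotropic(2) show ?thesis
    proof (cases rule: isotropic_cases)
      case (1 c')
      then have "c' \<noteq> 0" using uw(1) by (auto simp: independent_pair_def)
      then have "u = (c / c') *s w" using u 1 by simp
      then show ?thesis using uw(1) unfolding independent_pair_def by blast
    next
      case (2 c' Q t)
      then show ?thesis using u comb_p comb_pt by blast
    qed
  next
    case (2 c Q t)
    note u = this
    from isotropic(2) show ?thesis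
    proof (cases rule: isotropic_cases)
      case (1 c')
      then show ?thesis using u comb_p comb_pt by blast
    next
      case (2 c' Q' t')
      have "c * (c' ^ q * herm (pt Q t) (pt Q' t')) = 0"
        using orthogonal unfolding u(3) 2(3) herm_scale_left herm_scale_right
        by (simp only: mult.left_commute)
      then have "herm (pt Q t) (pt Q' t') = 0"
        using u(1) 2(1) by simp
      then have "Q = Q'" using orthogonal_pt u(2) 2(2) by blast
      then show ?thesis using u 2 comb_pt by blast
    qed
  qed
  then obtain Q a b a' b' where Q: "Q \<in> base_points" "u = a *s pt Q 0 + b *s p"
    "w = a' *s pt Q 0 + b' *s p"
    unfolding comb_def by blast
  have "plane (pt Q 0) p = plane u w"
    by (rule plane_cong[OF independent_pt[OF Q(1)] uw(1) Q(2,3)])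
  then show ?thesis using Q(1) uw(2) by (intro image_eqI[of _ _ Q]) (simp_all add: generator_def)
qed

section \<open>The section in coordinates along the generators\<close>

lemma rational_points_section:
  assumes "homogeneous d F"
  shows "rational_points (hermitian_variety q H \<inter> zero_locus F) =
    (if poly_fun F p = 0 then {rat_pt p} else {}) \<union>
    (\<lambda>(Q, t). rat_pt (pt Q t)) ` (SIGMA Q:base_points. {t. poly_fun F (pt Q t) = 0})"
    (is "?L = ?R")
proof (intro subset_antisym subsetI)
  fix R assume "R \<in> ?L"
  then obtain v where v: "R = rat_pt v" "v \<noteq> 0" "R \<in> hermitian_variety q H" "R \<in> zero_locus F"
    unfolding rational_points_eq by blast
  then have "herm v v = 0" by (simp add: rat_pt_in_hermitian_variety_iff)
  then show "R \<in> ?R"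
  proof (cases rule: isotropic_cases)
    case (1 c)
    then have "R = rat_pt p" using v(1,2) by (auto simp: rat_pt_scale)
    then show ?thesis
      using v(4) rat_pt_in_zero_locus_iff[OF assms p_nonzero] by auto
  next
    case (2 c Q t)
    then have R: "R = rat_pt (pt Q t)" using v(1) by (simp add: rat_pt_scale)
    then have "poly_fun F (pt Q t) = 0"
      using v(4) rat_pt_in_zero_locus_iff[OF assms pt_nonzero[OF 2(2)]] by blast
    then show ?thesis using R 2(2) by (intro UnI2 image_eqI[of _ _ "(Q, t)"]) auto
  qed
next
  fix R assume "R \<in> ?R"
  then consider "R = rat_pt p" "poly_fun F p = 0" | Q t where "R = rat_pt (pt Q t)"
    "Q \<in> base_points" "poly_fun F (pt Q t) = 0"
    by (auto split: if_splits)
  then show "R \<in> ?L"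
  proof cases
    case 1
    then show ?thesis
      using p_nonzero rat_pt_in_hermitian_variety_iff[OF p_nonzero]
        rat_pt_in_zero_locus_iff[OF assms p_nonzero]
      unfolding rational_points_eq by auto
  next
    case 2
    then show ?thesis
      using pt_nonzero[OF 2(2)] rat_pt_in_hermitian_variety_iff[OF pt_nonzero[OF 2(2)]]
        rat_pt_in_zero_locus_iff[OF assms pt_nonzero[OF 2(2)]] pt_isotropic[OF 2(2)]
      unfolding rational_points_eq by auto
  qed
qed

lemma card_rational_points_section:
  assumes "homogeneous d F"
  shows "card (rational_points (hermitian_variety q H \<inter> zero_locus F)) =
    (if poly_fun F p = 0 then 1 else 0) + (\<Sum>Q\<in>base_points. card {t. poly_fun F (pt Q t) = 0})"
proof -
  let ?B = "SIGMA Q:base_points. {t. poly_fun F (pt Q t) = 0}"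
  have sub: "?B \<subseteq> base_points \<times> UNIV" by blast
  have "card ((if poly_fun F p = 0 then {rat_pt p} else {}) \<union> (\<lambda>(Q, t). rat_pt (pt Q t)) ` ?B) =
      card (if poly_fun F p = 0 then {rat_pt p} else {}) + card ((\<lambda>(Q, t). rat_pt (pt Q t)) ` ?B)"
  proof (rule card_Un_disjoint)
    show "(if poly_fun F p = 0 then {rat_pt p} else {}) \<inter> (\<lambda>(Q, t). rat_pt (pt Q t)) ` ?B = {}"
      using vertex_notin_image[OF sub] by simp
  qed simp_all
  also have "card ((\<lambda>(Q, t). rat_pt (pt Q t)) ` ?B) = card ?B"
    by (rule card_image[OF inj_on_rat_pt_pt[OF sub]])
  also have "card ?B = (\<Sum>Q\<in>base_points. card {t. poly_fun F (pt Q t) = 0})"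
    by (rule card_SigmaI) simp_all
  finally show ?thesis
    unfolding rational_points_section[OF assms] by simp
qed

lemma section_is_union:
  assumes "1 \<le> d" "d \<le> q" "F \<noteq> 0" "homogeneous d F"
    and card: "card (rational_points (hermitian_variety q H \<inter> zero_locus F)) = 1 + q\<^sup>2 * d * (q + 1)"
  obtains S where "S \<subseteq> base_points" "card S = d * (q + 1)"
    "rational_points (hermitian_variety q H \<inter> zero_locus F) = (\<Union>Q\<in>S. rational_points (generator Q))"
proof -
  obtain c where c': "\<forall>x y z t. poly_fun F (x *s e0 + y *s e1 + z *s e2 + t *s p) =
      (\<Sum>(a, b, s)\<in>triples d. c (a, b, s) * (x ^ a * y ^ b * z ^ (d - a - b - s) * t ^ s))"
    using poly_fun_linear_substitution[OF assms(4), of e0 e1 e2 p]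
    unfolding quaternary_form_def by (elim exE)
  have c: "poly_fun F (frame e0 e1 e2 x y z t) =
      (\<Sum>(a, b, s)\<in>triples d. c (a, b, s) * (x ^ a * y ^ b * z ^ (d - a - b - s) * t ^ s))" for x y z t
    unfolding frame_def by (rule c'[rule_format])
  have "q < CARD('k)"
    using q_ge_2 by (simp add: card_K power2_eq_square)
  then obtain v where v: "poly_fun F v \<noteq> 0"
    using poly_fun_nonzero[OF assms(3,4)] assms(2) by (meson le_less_trans)
  \<comment> \<open>F is nonzero as a function because d \<le> q < q^2, and it stays so in frame
    coordinates because these reach every vector.\<close>
  have nonzero: "\<exists>r\<in>triples d. c r \<noteq> 0"
  proof (rule ccontr)
    assume "\<not> ?thesis"
    then have "poly_fun F (frame e0 e1 e2 x y z t) = 0" for x y z t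
      unfolding c by (intro sum.neutral) auto
    then show False using v frame_surj by metis
  qed
  have pt_eq: "poly_fun F (pt Q t) = (case Q of (x, y, z) \<Rightarrow> poly_fun F (frame e0 e1 e2 x y z t))" for Q t
    by (simp add: pt_def case_prod_beta)
  have "(\<Sum>(x, y, z)\<in>base_points. card {t. poly_fun F (frame e0 e1 e2 x y z t) = 0}) =
      (\<Sum>Q\<in>base_points. card {t. poly_fun F (pt Q t) = 0})"
    by (intro sum.cong refl) (simp add: pt_eq case_prod_beta)
  then have card': "(if poly_fun F (frame e0 e1 e2 0 0 0 1) = 0 then 1 else 0) +
      (\<Sum>(x, y, z)\<in>base_points. card {t. poly_fun F (frame e0 e1 e2 x y z t) = 0}) =
      1 + q\<^sup>2 * d * (q + 1)"
    using card unfolding card_rational_points_section[OF assms(4)] frame_vertex vec.scale_one by simp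
  obtain S where S: "S \<subseteq> base_points" "card S = d * (q + 1)"
    "poly_fun F (frame e0 e1 e2 0 0 0 1) = 0"
    "\<And>x y z t. (x, y, z) \<in> base_points \<Longrightarrow>
      poly_fun F (frame e0 e1 e2 x y z t) = 0 \<longleftrightarrow> (x, y, z) \<in> S"
    by (rule cone_section[OF assms(1,2) nonzero card'[unfolded c], folded c], rule that, assumption+)
  have "S \<noteq> {}" using S(2) assms(1) by auto
  have "(SIGMA Q:base_points. {t. poly_fun F (pt Q t) = 0}) = S \<times> UNIV"
    using S(1,4) by (auto simp: pt_eq)
  moreover have "poly_fun F p = 0" using S(3) by (simp add: frame_vertex)
  ultimately have "rational_points (hermitian_variety q H \<inter> zero_locus F) =
      (\<Union>Q\<in>S. rational_points (generator Q))"
    unfolding rational_points_section[OF assms(4)]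
      Union_rational_points_generator[OF S(1) \<open>S \<noteq> {}\<close>] by simp
  then show ?thesis by (rule that[OF S(1,2)])
qed

end

text \<open>The vertex is given by an incidence condition. Turning it into membership of its vector
  in the radical of \<open>H\<close> gives access to the normal form, after which both directions
  are statements about sets of base points.\<close>

theorem theorem3p7:
  fixes q d :: nat
    and PU :: "('k::{field, finite}, 4) proj_pt set"
    and P :: "('k, 4) proj_pt"
    and F :: "('k, 4) mv_poly"
  assumes "primepow q"
    and "CARD('k) = q ^ 2"
    and "1 \<le> d" and "d \<le> q"
    and "is_hermitian_variety_of_rank q 3 PU"
    and "P \<in> rational_points PU" and "is_cone_with_vertex P PU"
    and "F \<noteq> 0" and "homogeneous d F"
  shows "card (rational_points (PU \<inter> zero_locus F)) = 1 + q ^ 2 * d * (q + 1) \<longleftrightarrow>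
    (\<exists>\<L>. finite \<L> \<and> card \<L> = d * (q + 1) \<and>
       (\<forall>L\<in>\<L>. is_rational_line L \<and> L \<subseteq> PU) \<and>
       rational_points (PU \<inter> zero_locus F) = (\<Union>L\<in>\<L>. rational_points L))"
proof -
  obtain H :: "'k ^ 4 ^ 4" where H: "hermitian_matrix q H" "rank H = 3" "PU = hermitian_variety q H"
    using assms(5) unfolding is_hermitian_variety_of_rank_def by blast
  interpret hermitian_form q "TYPE('k)" H
    by unfold_locales fact+
  obtain p where p: "P = rat_pt p" "p \<noteq> 0" "rat_pt p \<in> PU"
    using assms(6) unfolding rational_points_eq by blast
  have "herm p p = 0"
    using p(3) rat_pt_in_hermitian_variety_iff[OF p(2)] H(3) by simp
  \<comment> \<open>Instances of the cone condition at rational isotropic points. They place p in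
    the radical, and later show that the generators lie on the surface.\<close>
  have cone: "projectivization (plane v p) \<subseteq> PU"
    if v: "herm v v = 0" "independent_pair v p" for v
  proof -
    have "v \<noteq> 0" using v(2) by (auto simp: independent_pair_def)
    have "v = 1 *s v + 0 *s p" "p = 0 *s v + 1 *s p" by simp_all
    then have mem: "rat_pt v \<in> projectivization (plane v p)" "P \<in> projectivization (plane v p)"
      unfolding p(1) rat_pt_in_plane_iff[OF \<open>v \<noteq> 0\<close> v(2)] rat_pt_in_plane_iff[OF p(2) v(2)] by blast+
    have "rat_pt v \<in> PU"
      using v(1) rat_pt_in_hermitian_variety_iff[OF \<open>v \<noteq> 0\<close>] H(3) by simp
    moreover have "rat_pt v \<noteq> P"
      using v(2) unfolding p(1) rat_pt_eq_iff[OF p(2)] by (simp add: independent_pair_def)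
    ultimately show ?thesis
      using assms(7) is_line_plane[OF v(2)] mem unfolding is_cone_with_vertex_def by blast
  qed
  have "p \<in> radical"
  proof (rule vertex_in_radical[OF \<open>herm p p = 0\<close>])
    fix v and c :: 'k assume v: "herm v v = 0"
    show "herm (p + c *s v) (p + c *s v) = 0"
    proof (cases "\<exists>k. v = k *s p")
      case True
      then show ?thesis using \<open>herm p p = 0\<close> by auto
    next
      case False
      then have ind: "independent_pair v p" using p(2) by (simp add: independent_pair_def)
      have nz: "p + c *s v \<noteq> 0"
      proof
        assume zero: "p + c *s v = 0"
        then have "c \<noteq> 0" using p(2) by auto
        have "v = (- 1 / c) *s p + (1 / c) *s (p + c *s v)"
          using \<open>c \<noteq> 0\<close> by (simp add: vec.scale_right_distrib)
        then have "v = (- 1 / c) *s p" by (simp only: zero) simp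
        then show False using False by blast
      qed
      have "p + c *s v = c *s v + 1 *s p" by (simp add: add.commute)
      then have "rat_pt (p + c *s v) \<in> projectivization (plane v p)"
        unfolding rat_pt_in_plane_iff[OF nz ind] by blast
      then have "rat_pt (p + c *s v) \<in> hermitian_variety q H"
        using cone[OF v ind] H(3) by blast
      then show ?thesis
        using rat_pt_in_hermitian_variety_iff[OF nz] by blast
    qed
  qed
  interpret hermitian_cone q "TYPE('k)" H p
    by unfold_locales fact+
  obtain e0 e1 e2 \<eta> where frame: "\<eta> \<noteq> 0" "\<eta> ^ q = \<eta>"
    "\<And>v. \<exists>x y z t. v = frame e0 e1 e2 x y z t"
    "\<And>x y z t x' y' z' t'. frame e0 e1 e2 x y z t = frame e0 e1 e2 x' y' z' t' \<Longrightarrow>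
      x = x' \<and> y = y' \<and> z = z' \<and> t = t'"
    "\<And>x y z t x' y' z' t'. herm (frame e0 e1 e2 x y z t) (frame e0 e1 e2 x' y' z' t') =
      \<eta> * x * x' ^ q + y * z' ^ q + z * y' ^ q"
    by (rule normal_form, rule that, assumption+)
  interpret framed_cone q "TYPE('k)" H p e0 e1 e2 \<eta>
    by unfold_locales (fact frame)+
  show ?thesis
  proof
    assume "card (rational_points (PU \<inter> zero_locus F)) = 1 + q ^ 2 * d * (q + 1)"
    then obtain S where S: "S \<subseteq> base_points" "card S = d * (q + 1)"
      "rational_points (PU \<inter> zero_locus F) = (\<Union>Q\<in>S. rational_points (generator Q))"
      unfolding H(3) by (rule section_is_union[OF assms(3,4,8,9)])
    have "card (generator ` S) = d * (q + 1)"
      using S(2) card_image[OF inj_on_subset[OF inj_on_generator S(1)]] by simp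
    moreover have "is_rational_line (generator Q)" "generator Q \<subseteq> PU" if "Q \<in> S" for Q
      using that S(1) is_rational_line_plane[OF independent_pt] cone[OF pt_isotropic independent_pt]
      unfolding generator_def by blast+
    ultimately show "\<exists>\<L>. finite \<L> \<and> card \<L> = d * (q + 1) \<and>
       (\<forall>L\<in>\<L>. is_rational_line L \<and> L \<subseteq> PU) \<and>
       rational_points (PU \<inter> zero_locus F) = (\<Union>L\<in>\<L>. rational_points L)"
      using S(3) by (intro exI[of _ "generator ` S"]) simp
  next
    assume "\<exists>\<L>. finite \<L> \<and> card \<L> = d * (q + 1) \<and>
       (\<forall>L\<in>\<L>. is_rational_line L \<and> L \<subseteq> PU) \<and>
       rational_points (PU \<inter> zero_locus F) = (\<Union>L\<in>\<L>. rational_points L)"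
    then obtain \<L> where L: "card \<L> = d * (q + 1)" "\<And>L. L \<in> \<L> \<Longrightarrow> is_rational_line L \<and> L \<subseteq> PU"
      "rational_points (PU \<inter> zero_locus F) = (\<Union>L\<in>\<L>. rational_points L)"
      by blast
    have "\<L> \<subseteq> generator ` base_points"
      using L(2) rational_line_is_generator H(3) by blast
    then obtain S where S: "S \<subseteq> base_points" "\<L> = generator ` S"
      by (meson subset_imageE)
    have card_S: "card S = d * (q + 1)"
      using L(1) S card_image[OF inj_on_subset[OF inj_on_generator S(1)]] by simp
    \<comment> \<open>Since d \<ge> 1 there is at least one generator, which supplies the vertex
      counted by the summand 1.\<close>
    then have "S \<noteq> {}" using assms(3) by auto
    show "card (rational_points (PU \<inter> zero_locus F)) = 1 + q ^ 2 * d * (q + 1)"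
      unfolding L(3) S(2) image_image
        card_Union_generators[OF S(1) \<open>S \<noteq> {}\<close>] by (simp only: card_S mult.assoc)
  qed
qed

end
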